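(* Let $p\ge 3$ be a prime and let $q$ be a prime such that either $q\equiv 1 \pmod 4$ and $\left(\frac{p}{q}\right)=-1$, or $q=2$ and $p\equiv 3\pmod 8$. Let $B=\left(\frac{q,p}{\mathbb{Q}}\right)$ and let $\tau=(B,R,j,\mathcal{C})$ be the special type defined in the context. Then $\tau$ does not satisfy the $\mathrm{QCFF}$ property; that is, there exists $\alpha\in B$ whose continued fraction expansion of type $\tau$ is infinite.
   Context: $B=\left(\frac{q,p}{\mathbb{Q}}\right)$ is the quaternion algebra over $\mathbb{Q}$ with standard generators $i,j$ with $i^2=q$, $j^2=p$, $ij=-ji$. Under the stated conditions $B$ is an indefinite division algebra ramified exactly at $p$ and $q$. Let $R$ be the maximal order $$R=\mathbb{Z}+\mathbb{Z}i+\mathbb{Z}j+\mathbb{Z}\tfrac{1+i+j+ij}{2}\ \text{ if } q=2,\qquad R=\mathbb{Z}+\mathbb{Z}i+\mathbb{Z}\tfrac{1+j}{2}+\mathbb{Z}\tfrac{i+ij}{2}\ \text{ otherwise.}$$ Let $B_p=B\otimes_{\mathbb{Q}}\mathbb{Q}_p$, a division algebra with non-archimedean absolute value $|\alpha|_p=p^{-v_p(\mathrm{nrd}(\alpha))/2}$, where $\mathrm{nrd}$ is the reduced norm; $j$ is a uniformizer. The set $$\mathcal{C}=\{a+bi \mid a,b\in\{0,\pm1,\dots,\pm\tfrac12(p-1)\}\}$$ is a complete set of representatives for $R/jR\cong\mathbb{F}_{p^2}$. Every $\alpha\in B_p$ can be written uniquely as $\alpha=\sum_{\ell=r}^{\infty}\alpha_\ell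 j^\ell$ with $\alpha_\ell\in\mathcal{C}$. Define the floor function $s:B_p\to B$ by $s(\alpha)=0$ if $r>0$ and $s(\alpha)=\sum_{\ell=r}^{0}\alpha_\ell j^\ell$ if $r\le0$. The type $\tau=(B,R,j,\mathcal{C})$ means $(B,R,p,s)$ with this $s$. The continued fraction expansion of type $\tau$ of $\alpha_0\in B_p$ is the sequence $[a_0,a_1,\dots]$ produced by $a_n=s(\alpha_n)$, $\alpha_{n+1}=(\alpha_n-a_n)^{-1}$ if $\alpha_n\neq a_n$, stopping if $\alpha_n=a_n$. A type satisfies the $\mathrm{QCFF}$ (Quaternionic Continued Fraction Finiteness) property if every $\alpha\in B$ has a finite expansion of that type. *)

theory Defs
  imports Complex_Main "HOL-Algebra.QuotRing" "HOL-Number_Theory.Number_Theory"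
begin

section \<open>The field of \<open>p\<close>-adic numbers\<close>

definition padic_val :: "nat \<Rightarrow> rat \<Rightarrow> int" where
  "padic_val p x = int (multiplicity (int p) (fst (quotient_of x)))
                 - int (multiplicity (int p) (snd (quotient_of x)))"

definition padic_abs :: "nat \<Rightarrow> rat \<Rightarrow> real" where
  "padic_abs p x = (if x = 0 then 0 else real p powi (- padic_val p x))"

definition rational_ring :: "rat ring" where
  "rational_ring = \<lparr>carrier = UNIV, monoid.mult = (*), one = 1, zero = 0, add = (+)\<rparr>"

definition padic_cauchy_ring :: "nat \<Rightarrow> (nat \<Rightarrow> rat) ring" where
  "padic_cauchy_ring p =
     \<lparr>carrier = {X. \<forall>e>0. \<exists>N. \<forall>m\<ge>N. \<forall>n\<ge>N. padic_abs p (X m - X n) < e},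
      monoid.mult = (\<lambda>X Y n. X n * Y n), one = (\<lambda>_. 1), zero = (\<lambda>_. 0),
      add = (\<lambda>X Y n. X n + Y n)\<rparr>"

definition padic_null :: "nat \<Rightarrow> (nat \<Rightarrow> rat) set" where
  "padic_null p = {X. (\<lambda>n. padic_abs p (X n)) \<longlonglongrightarrow> 0}"

text \<open>A \<open>p\<close>-adic number is a coset of null sequences in the ring of \<open>p\<close>-adic Cauchy sequences.\<close>

type_synonym padic = "(nat \<Rightarrow> rat) set"

definition padic_field :: "nat \<Rightarrow> padic ring" where
  "padic_field p = padic_cauchy_ring p Quot padic_null p"

definition padic_of_rat :: "nat \<Rightarrow> rat \<Rightarrow> padic" where
  "padic_of_rat p x = padic_null p +>\<^bsub>padic_cauchy_ring p\<^esub> (\<lambda>_. x)"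

definition padic_norm :: "nat \<Rightarrow> padic \<Rightarrow> real" where
  "padic_norm p x = (THE t. \<forall>X\<in>x. (\<lambda>n. padic_abs p (X n)) \<longlonglongrightarrow> t)"


section \<open>Quaternion algebras\<close>

text \<open>\<open>Quat x y z w\<close> stands for \<open>x + y i + z j + w ij\<close>.\<close>

datatype 'k quat = Quat (q1: 'k) (qi: 'k) (qj: 'k) (qij: 'k)

text \<open>
  The quaternion algebra over the commutative ring \<open>K\<close> with \<open>i\<^sup>2 = a\<close>, \<open>j\<^sup>2 = b\<close>, \<open>ij = -ji\<close>;
  consequently \<open>(ij)\<^sup>2 = -ab\<close>.
\<close>

definition quat_mult :: "('k, 'm) ring_scheme \<Rightarrow> 'k \<Rightarrow> 'k \<Rightarrow> 'k quat \<Rightarrow> 'k quat \<Rightarrow> 'k quat" where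
  "quat_mult K a b x y = Quat
     ((q1 x \<otimes>\<^bsub>K\<^esub> q1 y \<oplus>\<^bsub>K\<^esub> a \<otimes>\<^bsub>K\<^esub> (qi x \<otimes>\<^bsub>K\<^esub> qi y) \<oplus>\<^bsub>K\<^esub> b \<otimes>\<^bsub>K\<^esub> (qj x \<otimes>\<^bsub>K\<^esub> qj y))
        \<ominus>\<^bsub>K\<^esub> (a \<otimes>\<^bsub>K\<^esub> b) \<otimes>\<^bsub>K\<^esub> (qij x \<otimes>\<^bsub>K\<^esub> qij y))
     ((q1 x \<otimes>\<^bsub>K\<^esub> qi y \<oplus>\<^bsub>K\<^esub> qi x \<otimes>\<^bsub>K\<^esub> q1 y \<oplus>\<^bsub>K\<^esub> b \<otimes>\<^bsub>K\<^esub> (qij x \<otimes>\<^bsub>K\<^esub> qj y))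
        \<ominus>\<^bsub>K\<^esub> b \<otimes>\<^bsub>K\<^esub> (qj x \<otimes>\<^bsub>K\<^esub> qij y))
     ((q1 x \<otimes>\<^bsub>K\<^esub> qj y \<oplus>\<^bsub>K\<^esub> qj x \<otimes>\<^bsub>K\<^esub> q1 y \<oplus>\<^bsub>K\<^esub> a \<otimes>\<^bsub>K\<^esub> (qi x \<otimes>\<^bsub>K\<^esub> qij y))
        \<ominus>\<^bsub>K\<^esub> a \<otimes>\<^bsub>K\<^esub> (qij x \<otimes>\<^bsub>K\<^esub> qi y))
     ((q1 x \<otimes>\<^bsub>K\<^esub> qij y \<oplus>\<^bsub>K\<^esub> qij x \<otimes>\<^bsub>K\<^esub> q1 y \<oplus>\<^bsub>K\<^esub> qi x \<otimes>\<^bsub>K\<^esub> qj y)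
        \<ominus>\<^bsub>K\<^esub> qj x \<otimes>\<^bsub>K\<^esub> qi y)"

definition quat_alg :: "('k, 'm) ring_scheme \<Rightarrow> 'k \<Rightarrow> 'k \<Rightarrow> 'k quat ring" where
  "quat_alg K a b =
     \<lparr>carrier = {x. q1 x \<in> carrier K \<and> qi x \<in> carrier K \<and> qj x \<in> carrier K \<and> qij x \<in> carrier K},
      monoid.mult = quat_mult K a b,
      one = Quat \<one>\<^bsub>K\<^esub> \<zero>\<^bsub>K\<^esub> \<zero>\<^bsub>K\<^esub> \<zero>\<^bsub>K\<^esub>,
      zero = Quat \<zero>\<^bsub>K\<^esub> \<zero>\<^bsub>K\<^esub> \<zero>\<^bsub>K\<^esub> \<zero>\<^bsub>K\<^esub>,
      add = (\<lambda>x y. Quat (q1 x \<oplus>\<^bsub>K\<^esub> q1 y) (qi x \<oplus>\<^bsub>K\<^esub> qi y)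
                        (qj x \<oplus>\<^bsub>K\<^esub> qj y) (qij x \<oplus>\<^bsub>K\<^esub> qij y))\<rparr>"

definition quat_nrd :: "('k, 'm) ring_scheme \<Rightarrow> 'k \<Rightarrow> 'k \<Rightarrow> 'k quat \<Rightarrow> 'k" where
  "quat_nrd K a b x =
     ((q1 x \<otimes>\<^bsub>K\<^esub> q1 x \<ominus>\<^bsub>K\<^esub> a \<otimes>\<^bsub>K\<^esub> (qi x \<otimes>\<^bsub>K\<^esub> qi x)) \<ominus>\<^bsub>K\<^esub> b \<otimes>\<^bsub>K\<^esub> (qj x \<otimes>\<^bsub>K\<^esub> qj x))
       \<oplus>\<^bsub>K\<^esub> (a \<otimes>\<^bsub>K\<^esub> b) \<otimes>\<^bsub>K\<^esub> (qij x \<otimes>\<^bsub>K\<^esub> qij x)"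

abbreviation quat_alg_rat :: "rat \<Rightarrow> rat \<Rightarrow> rat quat ring" where
  "quat_alg_rat a b \<equiv> quat_alg rational_ring a b"

text \<open>
  The localisation \<open>B \<otimes> \<rat>\<^sub>p\<close> of the rational quaternion algebra \<open>B\<close> with parameters \<open>a\<close>, \<open>b\<close>
  is the quaternion algebra with the same parameters over the \<open>p\<close>-adic numbers.
\<close>

definition quat_alg_padic :: "nat \<Rightarrow> rat \<Rightarrow> rat \<Rightarrow> padic quat ring" where
  "quat_alg_padic p a b = quat_alg (padic_field p) (padic_of_rat p a) (padic_of_rat p b)"

definition quat_embed :: "nat \<Rightarrow> rat quat \<Rightarrow> padic quat" where
  "quat_embed p = map_quat (padic_of_rat p)"

text \<open>\<open>\<bar>x\<bar>\<^sub>p = p\<close> to the power \<open>-v\<^sub>p(nrd x)/2\<close>, i.e. the square root of the \<open>p\<close>-adic norm of \<open>nrd x\<close>.\<close>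

definition quat_abs :: "nat \<Rightarrow> rat \<Rightarrow> rat \<Rightarrow> padic quat \<Rightarrow> real" where
  "quat_abs p a b x =
     sqrt (padic_norm p (quat_nrd (padic_field p) (padic_of_rat p a) (padic_of_rat p b) x))"


section \<open>Types and continued fractions\<close>

text \<open>
  A type \<open>(B, R, p, s)\<close>: the algebra \<open>B\<close> is given by its two parameters, \<open>R\<close> is an order of \<open>B\<close>,
  and \<open>s\<close> is the floor function from \<open>B \<otimes> \<rat>\<^sub>p\<close> to \<open>B\<close>.
\<close>

record quat_type =
  type_a :: rat
  type_b :: rat
  type_order :: "rat quat set"
  type_prime :: nat
  type_floor :: "padic quat \<Rightarrow> rat quat"

definition type_alg :: "quat_type \<Rightarrow> rat quat ring" where
  "type_alg \<tau> = quat_alg_rat (type_a \<tau>) (type_b \<tau>)"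

definition type_alg_padic :: "quat_type \<Rightarrow> padic quat ring" where
  "type_alg_padic \<tau> = quat_alg_padic (type_prime \<tau>) (type_a \<tau>) (type_b \<tau>)"

abbreviation type_embed :: "quat_type \<Rightarrow> rat quat \<Rightarrow> padic quat" where
  "type_embed \<tau> \<equiv> quat_embed (type_prime \<tau>)"

text \<open>The complete quotients \<open>\<alpha>\<^sub>n\<close>; \<open>None\<close> once the expansion has stopped.\<close>

primrec complete_quot :: "quat_type \<Rightarrow> padic quat \<Rightarrow> nat \<Rightarrow> padic quat option" where
  "complete_quot \<tau> \<alpha> 0 = Some \<alpha>"
| "complete_quot \<tau> \<alpha> (Suc n) =
     (case complete_quot \<tau> \<alpha> n of
        None \<Rightarrow> None
      | Some \<beta> \<Rightarrow>
          let a = type_embed \<tau> (type_floor \<tau> \<beta>) in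
            if \<beta> = a then None
            else Some (inv\<^bsub>type_alg_padic \<tau>\<^esub> (\<beta> \<ominus>\<^bsub>type_alg_padic \<tau>\<^esub> a)))"

definition cf_expansion :: "quat_type \<Rightarrow> padic quat \<Rightarrow> nat \<Rightarrow> rat quat option" where
  "cf_expansion \<tau> \<alpha> n = map_option (type_floor \<tau>) (complete_quot \<tau> \<alpha> n)"

definition finite_cf_expansion :: "quat_type \<Rightarrow> padic quat \<Rightarrow> bool" where
  "finite_cf_expansion \<tau> \<alpha> \<longleftrightarrow> (\<exists>n. cf_expansion \<tau> \<alpha> n = None)"

definition QCFF :: "quat_type \<Rightarrow> bool" where
  "QCFF \<tau> \<longleftrightarrow> (\<forall>\<alpha>\<in>carrier (type_alg \<tau>). finite_cf_expansion \<tau> (type_embed \<tau> \<alpha>))"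


section \<open>Special types\<close>

text \<open>
  \<open>digit_expansion p a b u C \<alpha> r c\<close>: the digits \<open>c l\<close> lie in \<open>C\<close> and the partial sums of
  \<open>\<Sum>l\<ge>r. c l u\<^sup>l\<close> converge to \<open>\<alpha>\<close>.  The values \<open>c l\<close> for \<open>l < r\<close> play no role.
\<close>

definition digit_sum :: "rat \<Rightarrow> rat \<Rightarrow> rat quat \<Rightarrow> (int \<Rightarrow> rat quat) \<Rightarrow> int \<Rightarrow> int \<Rightarrow> rat quat" where
  "digit_sum a b u c r N =
     (\<Oplus>\<^bsub>quat_alg_rat a b\<^esub> l\<in>{r..N}. c l \<otimes>\<^bsub>quat_alg_rat a b\<^esub> (u [^]\<^bsub>quat_alg_rat a b\<^esub> l))"

definition digit_expansion ::
  "nat \<Rightarrow> rat \<Rightarrow> rat \<Rightarrow> rat quat \<Rightarrow> rat quat set \<Rightarrow> padic quat \<Rightarrow> int \<Rightarrow> (int \<Rightarrow> rat quat) \<Rightarrow> bool" where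
  "digit_expansion p a b u C \<alpha> r c \<longleftrightarrow>
     (\<forall>l\<ge>r. c l \<in> C) \<and>
     (\<lambda>n. quat_abs p a b
            (\<alpha> \<ominus>\<^bsub>quat_alg_padic p a b\<^esub> quat_embed p (digit_sum a b u c r (int n)))) \<longlonglongrightarrow> 0"

text \<open>
  Expansions of the same \<open>\<alpha>\<close> with different \<open>r\<close> differ only by leading zero digits, which do not
  affect the value of the floor.
\<close>

definition special_floor ::
  "nat \<Rightarrow> rat \<Rightarrow> rat \<Rightarrow> rat quat \<Rightarrow> rat quat set \<Rightarrow> padic quat \<Rightarrow> rat quat" where
  "special_floor p a b u C \<alpha> =
     (THE \<beta>. \<exists>r c. digit_expansion p a b u C \<alpha> r c \<and>
        \<beta> = (if r > 0 then \<zero>\<^bsub>quat_alg_rat a b\<^esub> else digit_sum a b u c r 0))"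

definition int_span4 ::
  "rat quat ring \<Rightarrow> rat quat \<Rightarrow> rat quat \<Rightarrow> rat quat \<Rightarrow> rat quat \<Rightarrow> rat quat set" where
  "int_span4 B e1 e2 e3 e4 =
     {[(k1::int)] \<cdot>\<^bsub>B\<^esub> e1 \<oplus>\<^bsub>B\<^esub> [(k2::int)] \<cdot>\<^bsub>B\<^esub> e2 \<oplus>\<^bsub>B\<^esub> [(k3::int)] \<cdot>\<^bsub>B\<^esub> e3 \<oplus>\<^bsub>B\<^esub> [(k4::int)] \<cdot>\<^bsub>B\<^esub> e4
      | k1 k2 k3 k4. True}"

definition special_order :: "nat \<Rightarrow> nat \<Rightarrow> rat quat set" where
  "special_order q p =
     (let B = quat_alg_rat (of_nat q) (of_nat p) in
      if q = 2
      then int_span4 B (Quat 1 0 0 0) (Quat 0 1 0 0) (Quat 0 0 1 0) (Quat (1/2) (1/2) (1/2) (1/2))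
      else int_span4 B (Quat 1 0 0 0) (Quat 0 1 0 0) (Quat (1/2) 0 (1/2) 0) (Quat 0 (1/2) 0 (1/2)))"

definition special_digits :: "nat \<Rightarrow> rat quat set" where
  "special_digits p =
     {Quat (of_int a) (of_int b) 0 0 | (a::int) (b::int).
        \<bar>a\<bar> \<le> (int p - 1) div 2 \<and> \<bar>b\<bar> \<le> (int p - 1) div 2}"

text \<open>The uniformiser of the special type is \<open>j\<close>, i.e. \<open>Quat 0 0 1 0\<close>.\<close>

definition special_type :: "nat \<Rightarrow> nat \<Rightarrow> quat_type" where
  "special_type q p =
     \<lparr>type_a = of_nat q, type_b = of_nat p,
      type_order = special_order q p,
      type_prime = p,
      type_floor = special_floor p (of_nat q) (of_nat p) (Quat 0 0 1 0) (special_digits p)\<rparr>"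

end

theory Submission
  imports Defs
begin

text \<open>
  Write \<open>B\<close> for the quaternion algebra and \<open>L = \<int>[1/p] + \<int>[1/p] i + \<int>[1/p] j + \<int>[1/p] ij\<close>.  The digits
  \<open>a + b i\<close> have integer coordinates, so every value of the floor function lies in the ring \<open>L\<close>
  (\<open>special_floor_embed\<close>).  This ring is not maximal at the prime 2, and that is the obstruction to
  finiteness.

  For \<open>\<alpha> \<in> B\<close> consider the left \<open>L\<close>-module \<open>L\<alpha> + L\<close>.  If \<open>a \<in> L\<close> and \<open>\<beta> = (\<alpha> - a)\<^sup>-\<^sup>1\<close>, then
  \<open>L\<alpha> + L = L(\<alpha> - a) + L = (L + L\<beta>)(\<alpha> - a)\<close>, so the modules of \<open>\<alpha>\<close> and \<open>\<beta>\<close> differ by a right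
  factor and are stable under left multiplication by the same elements of \<open>B\<close>
  (\<open>left_multiplier_quotient\<close>).  An expansion that stops ends with some \<open>\<alpha>\<^sub>n \<in> L\<close>, whose module is \<open>L\<close>
  itself; since \<open>1 \<in> L\<close>, the elements that stabilise it lie in \<open>L\<close> (\<open>left_multiplier_in\<close>).  Hence \<open>\<alpha>\<close>
  has an infinite expansion as soon as \<open>L\<alpha> + L\<close> is stable under some \<open>e \<notin> L\<close>
  (\<open>infinite_expansion\<close>).  For \<open>q \<equiv> 1 (mod 4)\<close> take \<open>\<alpha> = e = (1 + i)/2\<close>, and for \<open>q = 2\<close> take
  \<open>\<alpha> = e = (i + ij)/2\<close>.  In both cases \<open>Le + L\<close> is a ring that contains \<open>e\<close>, so it is stable under
  \<open>e\<close>, and \<open>e \<notin> L\<close> because of the denominators 2.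

  It remains to know that the expansion of an element of \<open>B\<close> takes place inside \<open>B\<close>, with the floors
  described above.  The embedding of \<open>B\<close> into \<open>B \<otimes> \<rat>\<^sub>p\<close> is an injective ring homomorphism which
  turns the norm into the \<open>p\<close>-adic absolute value of the rational norm, so everything can be computed
  with rational quaternions.  The hypotheses on \<open>p\<close> and \<open>q\<close> make \<open>q\<close> a quadratic non-residue modulo
  \<open>p\<close>.  Therefore \<open>\<bar>nrd x\<bar>\<close> is the maximum of the contributions of the coordinates of \<open>x\<close>
  (\<open>padic_abs_nrd\<close>).  It follows that \<open>B\<close> is a division algebra, that convergence in norm is
  convergence of the coordinates, and that the floor is well defined: existence is the usual digit
  algorithm (\<open>digit_expansion_exists\<close>), and uniqueness holds because a floor has coordinates in
  \<open>\<int>[1/p]\<close> that are too small to be changed by an element of positive valuation (\<open>floor_unique\<close>).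
\<close>

section \<open>Quaternion algebras over commutative rings\<close>

lemma quat_alg_simps:
  "carrier (quat_alg K a b) =
     {x. q1 x \<in> carrier K \<and> qi x \<in> carrier K \<and> qj x \<in> carrier K \<and> qij x \<in> carrier K}"
  "x \<otimes>\<^bsub>quat_alg K a b\<^esub> y = quat_mult K a b x y"
  "x \<oplus>\<^bsub>quat_alg K a b\<^esub> y = Quat (q1 x \<oplus>\<^bsub>K\<^esub> q1 y) (qi x \<oplus>\<^bsub>K\<^esub> qi y)
     (qj x \<oplus>\<^bsub>K\<^esub> qj y) (qij x \<oplus>\<^bsub>K\<^esub> qij y)"
  "\<one>\<^bsub>quat_alg K a b\<^esub> = Quat \<one>\<^bsub>K\<^esub> \<zero>\<^bsub>K\<^esub> \<zero>\<^bsub>K\<^esub> \<zero>\<^bsub>K\<^esub>"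
  "\<zero>\<^bsub>quat_alg K a b\<^esub> = Quat \<zero>\<^bsub>K\<^esub> \<zero>\<^bsub>K\<^esub> \<zero>\<^bsub>K\<^esub> \<zero>\<^bsub>K\<^esub>"
  by (simp_all add: quat_alg_def)

text \<open>
  Associativity and distributivity are polynomial identities in the coordinates.  Expanding the products,
  sorting the factors and sorting the summands are separate passes, which keeps the rewriting short.
\<close>

lemma (in cring) quat_alg_is_ring:
  assumes "a \<in> carrier R" "b \<in> carrier R"
  shows "ring (quat_alg R a b)"
proof (rule ringI)
  show "abelian_group (quat_alg R a b)"
  proof (rule abelian_groupI)
    fix x assume x: "x \<in> carrier (quat_alg R a b)"
    show "\<exists>y\<in>carrier (quat_alg R a b). y \<oplus>\<^bsub>quat_alg R a b\<^esub> x = \<zero>\<^bsub>quat_alg R a b\<^esub>"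
      using x by (intro bexI[of _ "map_quat (a_inv R) x"])
        (auto simp: quat_alg_simps quat.map_sel l_neg)
  qed (auto simp: quat_alg_simps a_assoc intro: a_comm quat.expand)
  show "Group.monoid (quat_alg R a b)"
  proof (rule monoidI)
    fix x y z assume "x \<in> carrier (quat_alg R a b)" "y \<in> carrier (quat_alg R a b)"
      "z \<in> carrier (quat_alg R a b)"
    then show "x \<otimes>\<^bsub>quat_alg R a b\<^esub> y \<otimes>\<^bsub>quat_alg R a b\<^esub> z =
      x \<otimes>\<^bsub>quat_alg R a b\<^esub> (y \<otimes>\<^bsub>quat_alg R a b\<^esub> z)"
      using assms
      apply (simp add: quat_alg_simps quat_mult_def minus_eq)
      apply (simp add: l_distr r_distr l_minus r_minus minus_add)
      apply (simp add: m_ac)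
      apply (simp add: a_ac)
      done
  qed (use assms in \<open>auto simp: quat_alg_simps quat_mult_def minus_eq\<close>)
next
  fix x y z assume *: "x \<in> carrier (quat_alg R a b)" "y \<in> carrier (quat_alg R a b)"
      "z \<in> carrier (quat_alg R a b)"
  show "(x \<oplus>\<^bsub>quat_alg R a b\<^esub> y) \<otimes>\<^bsub>quat_alg R a b\<^esub> z =
       x \<otimes>\<^bsub>quat_alg R a b\<^esub> z \<oplus>\<^bsub>quat_alg R a b\<^esub> y \<otimes>\<^bsub>quat_alg R a b\<^esub> z"
      using assms *
      apply (simp add: quat_alg_simps quat_mult_def minus_eq)
      apply (simp add: l_distr r_distr l_minus r_minus minus_add)
      apply (simp add: m_ac)
      apply (simp add: a_ac)
      done
  show "z \<otimes>\<^bsub>quat_alg R a b\<^esub> (x \<oplus>\<^bsub>quat_alg R a b\<^esub> y) =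
       z \<otimes>\<^bsub>quat_alg R a b\<^esub> x \<oplus>\<^bsub>quat_alg R a b\<^esub> z \<otimes>\<^bsub>quat_alg R a b\<^esub> y"
      using assms *
      apply (simp add: quat_alg_simps quat_mult_def minus_eq)
      apply (simp add: l_distr r_distr l_minus r_minus minus_add)
      apply (simp add: m_ac)
      apply (simp add: a_ac)
      done
qed

lemma (in ring_hom_cring) map_quat_mult:
  assumes "a \<in> carrier R" "b \<in> carrier R"
    "x \<in> carrier (quat_alg R a b)" "y \<in> carrier (quat_alg R a b)"
  shows "map_quat h (quat_mult R a b x y) = quat_mult S (h a) (h b) (map_quat h x) (map_quat h y)"
  using assms by (simp add: quat_mult_def quat_alg_simps R.minus_eq S.minus_eq quat.map_sel)

lemma (in ring_hom_cring) map_quat_hom: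
  assumes "a \<in> carrier R" "b \<in> carrier R"
  shows "ring_hom_ring (quat_alg R a b) (quat_alg S (h a) (h b)) (map_quat h)"
proof (rule ring_hom_ringI2)
  show "map_quat h \<in> ring_hom (quat_alg R a b) (quat_alg S (h a) (h b))"
    using assms by (intro ring_hom_memI)
      (auto simp: quat_alg_simps map_quat_mult quat.map_sel intro: quat.expand)
qed (use assms in \<open>auto intro: R.quat_alg_is_ring S.quat_alg_is_ring\<close>)

lemma (in ring_hom_cring) map_quat_nrd:
  assumes "a \<in> carrier R" "b \<in> carrier R" "x \<in> carrier (quat_alg R a b)"
  shows "quat_nrd S (h a) (h b) (map_quat h x) = h (quat_nrd R a b x)"
  using assms by (simp add: quat_nrd_def quat_alg_simps R.minus_eq S.minus_eq quat.map_sel)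

section \<open>Rational quaternion algebras\<close>

lemma rational_ring_simps:
  "carrier rational_ring = UNIV" "x \<otimes>\<^bsub>rational_ring\<^esub> y = x * y"
  "x \<oplus>\<^bsub>rational_ring\<^esub> y = x + y" "\<one>\<^bsub>rational_ring\<^esub> = 1" "\<zero>\<^bsub>rational_ring\<^esub> = 0"
  by (simp_all add: rational_ring_def)

lemma cring_rational_ring: "cring rational_ring"
proof (rule cringI)
  show "abelian_group rational_ring"
    by (rule abelian_groupI) (auto simp: rational_ring_simps intro: exI[of _ "- x" for x])
  show "comm_monoid rational_ring"
    by (rule comm_monoidI) (auto simp: rational_ring_simps)
qed (auto simp: rational_ring_simps algebra_simps)

interpretation rat: cring rational_ring by (rule cring_rational_ring)

lemma rational_ring_minus: "x \<ominus>\<^bsub>rational_ring\<^esub> y = x - y"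
proof -
  have "\<ominus>\<^bsub>rational_ring\<^esub> y = - y"
    using rat.minus_equality[of "- y" y] by (simp add: rational_ring_simps)
  then show ?thesis by (simp add: rat.minus_eq rational_ring_simps)
qed

lemma quat_mult_rat:
  "quat_mult rational_ring a b x y = Quat
     (q1 x * q1 y + a * (qi x * qi y) + b * (qj x * qj y) - a * b * (qij x * qij y))
     (q1 x * qi y + qi x * q1 y + b * (qij x * qj y) - b * (qj x * qij y))
     (q1 x * qj y + qj x * q1 y + a * (qi x * qij y) - a * (qij x * qi y))
     (q1 x * qij y + qij x * q1 y + qi x * qj y - qj x * qi y)"
  by (simp add: quat_mult_def rational_ring_simps rational_ring_minus)

text \<open>
  The bracketing exhibits \<open>nrd x\<close> as \<open>N(z) - b N(w)\<close> for \<open>x = z + w j\<close>, where \<open>N\<close> is the norm form of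
  the quadratic algebra generated by \<open>i\<close>.
\<close>

lemma quat_nrd_rat:
  "quat_nrd rational_ring a b x =
     (q1 x * q1 x - a * (qi x * qi x)) - b * (qj x * qj x - a * (qij x * qij x))"
  by (simp add: quat_nrd_def rational_ring_simps rational_ring_minus algebra_simps)

lemma ring_quat_alg_rat: "ring (quat_alg_rat a b)"
  by (rule rat.quat_alg_is_ring) (auto simp: rational_ring_simps)

interpretation quat_rat: ring "quat_alg_rat a b" for a b by (rule ring_quat_alg_rat)

lemma quat_alg_rat_simps:
  "carrier (quat_alg_rat a b) = UNIV"
  "x \<otimes>\<^bsub>quat_alg_rat a b\<^esub> y = quat_mult rational_ring a b x y"
  "x \<oplus>\<^bsub>quat_alg_rat a b\<^esub> y = Quat (q1 x + q1 y) (qi x + qi y) (qj x + qj y) (qij x + qij y)"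
  "\<one>\<^bsub>quat_alg_rat a b\<^esub> = Quat 1 0 0 0"
  "\<zero>\<^bsub>quat_alg_rat a b\<^esub> = Quat 0 0 0 0"
  by (simp_all add: quat_alg_simps rational_ring_simps)

lemma quat_alg_rat_minus:
  "x \<ominus>\<^bsub>quat_alg_rat a b\<^esub> y = Quat (q1 x - q1 y) (qi x - qi y) (qj x - qj y) (qij x - qij y)"
proof -
  have "\<ominus>\<^bsub>quat_alg_rat a b\<^esub> y = Quat (- q1 y) (- qi y) (- qj y) (- qij y)"
    by (rule quat_rat.minus_equality) (auto simp: quat_alg_rat_simps)
  then show ?thesis by (simp add: quat_rat.minus_eq quat_alg_rat_simps)
qed

text \<open>
  The inverse is the conjugate divided by the norm.
\<close>

lemma quat_alg_rat_inv:
  assumes "quat_nrd rational_ring a b x \<noteq> 0"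
  shows "\<exists>y. x \<otimes>\<^bsub>quat_alg_rat a b\<^esub> y = \<one>\<^bsub>quat_alg_rat a b\<^esub> \<and>
             y \<otimes>\<^bsub>quat_alg_rat a b\<^esub> x = \<one>\<^bsub>quat_alg_rat a b\<^esub>"
proof -
  define m where "m = inverse (quat_nrd rational_ring a b x)"
  have "m * quat_nrd rational_ring a b x = 1" using assms by (simp add: m_def)
  then have "m * (q1 x * q1 x - a * (qi x * qi x) - b * (qj x * qj x - a * (qij x * qij x))) = 1"
    by (simp add: quat_nrd_rat)
  then show ?thesis
    by (intro exI[of _ "Quat (q1 x * m) (- qi x * m) (- qj x * m) (- qij x * m)"])
      (simp add: quat_alg_rat_simps quat_mult_rat algebra_simps)
qed

lemma finsum_quat_alg_rat:
  assumes "finite A"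
  shows "finsum (quat_alg_rat a b) f A =
    Quat (\<Sum>l\<in>A. q1 (f l)) (\<Sum>l\<in>A. qi (f l)) (\<Sum>l\<in>A. qj (f l)) (\<Sum>l\<in>A. qij (f l))"
  using assms
proof (induction A rule: finite_induct)
  case empty
  then show ?case by (simp add: quat_alg_rat_simps)
next
  case (insert x A)
  have "finsum (quat_alg_rat a b) f (insert x A) = f x \<oplus>\<^bsub>quat_alg_rat a b\<^esub> finsum (quat_alg_rat a b) f A"
    by (rule quat_rat.finsum_insert) (use insert in \<open>auto simp: quat_alg_rat_simps\<close>)
  then show ?case using insert by (simp add: quat_alg_rat_simps)
qed

section \<open>The \<open>p\<close>-adic absolute value on the rationals\<close>

context
  fixes p :: nat
  assumes p: "prime p"
begin

lemma int_p: "prime (int p)" and p_gt_1: "real p > 1"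
  using p prime_gt_1_nat[OF p] by auto

lemma padic_val_frac:
  assumes "a \<noteq> 0" "b \<noteq> 0"
  shows "padic_val p (of_int a / of_int b) =
    int (multiplicity (int p) a) - int (multiplicity (int p) b)"
proof -
  obtain c d where cd: "quotient_of (of_int a / of_int b) = (c, d)" by fastforce
  have eq: "(of_int a / of_int b :: rat) = of_int c / of_int d"
    by (rule quotient_of_div[OF cd])
  have d: "d > 0" using quotient_of_denom_pos[OF cd] .
  have c: "c \<noteq> 0" using eq assms d by auto
  have "(of_int (a * d) :: rat) = of_int (c * b)"
    using eq assms d by (simp add: field_simps)
  then have "a * d = c * b" by (simp only: of_int_eq_iff)
  then have "multiplicity (int p) (a * d) = multiplicity (int p) (c * b)" by simp
  then have "multiplicity (int p) a + multiplicity (int p) d =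
      multiplicity (int p) c + multiplicity (int p) b"
    using assms c d int_p by (simp add: prime_elem_multiplicity_mult_distrib)
  then show ?thesis by (simp add: padic_val_def cd)
qed

lemma rat_frac:
  fixes x :: rat
  obtains a b where "x = of_int a / of_int b" "b > 0" "coprime a b"
proof -
  obtain a b where ab: "quotient_of x = (a, b)" by fastforce
  show ?thesis
    by (rule that[of a b])
      (use quotient_of_div[OF ab] quotient_of_denom_pos[OF ab] quotient_of_coprime[OF ab] in auto)
qed

lemma padic_abs_frac:
  assumes "a \<noteq> 0" "b \<noteq> 0"
  shows "padic_abs p (of_int a / of_int b) =
    real p powi (int (multiplicity (int p) b) - int (multiplicity (int p) a))"
  using assms by (simp add: padic_abs_def padic_val_frac)

lemma padic_abs_0 [simp]: "padic_abs p 0 = 0"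
  by (simp add: padic_abs_def)

lemma padic_abs_eq_0_iff [simp]: "padic_abs p x = 0 \<longleftrightarrow> x = 0"
  using p_gt_1 by (simp add: padic_abs_def)

lemma padic_abs_nonneg [simp]: "padic_abs p x \<ge> 0"
  by (simp add: padic_abs_def)

lemma padic_abs_pos: "x \<noteq> 0 \<Longrightarrow> padic_abs p x > 0"
  using padic_abs_nonneg[of x] padic_abs_eq_0_iff[of x] by linarith

lemma padic_abs_mult [simp]: "padic_abs p (x * y) = padic_abs p x * padic_abs p y"
proof (cases "x = 0 \<or> y = 0")
  case False
  obtain a b where x: "x = of_int a / of_int b" "b > 0" by (rule rat_frac)
  obtain c d where y: "y = of_int c / of_int d" "d > 0" by (rule rat_frac)
  have nz: "a \<noteq> 0" "c \<noteq> 0" using False x y by auto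
  have "x * y = of_int (a * c) / of_int (b * d)" using x y by simp
  then have "padic_abs p (x * y) = real p powi
      (int (multiplicity (int p) (b * d)) - int (multiplicity (int p) (a * c)))"
    using padic_abs_frac[of "a * c" "b * d"] nz x y by simp
  also have "\<dots> = real p powi ((int (multiplicity (int p) b) - int (multiplicity (int p) a))
      + (int (multiplicity (int p) d) - int (multiplicity (int p) c)))"
    using nz x y int_p by (simp add: prime_elem_multiplicity_mult_distrib algebra_simps)
  also have "\<dots> = padic_abs p x * padic_abs p y"
    unfolding x(1) y(1) using nz x(2) y(2) p_gt_1
    by (subst power_int_add) (simp_all add: padic_abs_frac)
  finally show ?thesis .
qed auto

lemma padic_abs_1 [simp]: "padic_abs p 1 = 1"
  using padic_abs_frac[of 1 1] by simp

lemma padic_abs_minus [simp]: "padic_abs p (- x) = padic_abs p x"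
proof -
  have "padic_abs p (-1) = 1"
    using padic_abs_mult[of "-1" "-1"] padic_abs_nonneg[of "-1"] padic_abs_1
    by (simp add: square_eq_1_iff)
  then show ?thesis using padic_abs_mult[of "-1" x] by simp
qed

lemma padic_abs_diff_commute: "padic_abs p (x - y) = padic_abs p (y - x)"
  using padic_abs_minus[of "x - y"] by simp

lemma padic_abs_power [simp]: "padic_abs p (x ^ n) = padic_abs p x ^ n"
  by (induction n) auto

lemma padic_abs_inverse [simp]: "padic_abs p (inverse x) = inverse (padic_abs p x)"
proof (cases "x = 0")
  case False
  then have "padic_abs p x * padic_abs p (inverse x) = 1"
    by (simp flip: padic_abs_mult)
  then show ?thesis using False by (simp add: field_simps)
qed auto

lemma padic_abs_divide [simp]: "padic_abs p (x / y) = padic_abs p x / padic_abs p y"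
  by (simp add: divide_inverse)

lemma padic_abs_of_int:
  "n \<noteq> 0 \<Longrightarrow> padic_abs p (of_int n) = real p powi (- int (multiplicity (int p) n))"
  using padic_abs_frac[of n 1] by simp

lemma padic_abs_p [simp]: "padic_abs p (of_nat p) = 1 / real p"
proof -
  have "padic_abs p (of_int (int p)) = real p powi (- int (multiplicity (int p) (int p)))"
    by (rule padic_abs_of_int) (use p_gt_1 in auto)
  also have "multiplicity (int p) (int p) = 1"
    using int_p by (intro multiplicity_self) auto
  finally show ?thesis by (simp add: power_int_minus field_simps)
qed

lemma padic_abs_of_int_le_1: "padic_abs p (of_int n) \<le> 1"
proof (cases "n = 0")
  case False
  then show ?thesis
    using p_gt_1 by (simp add: padic_abs_of_int power_int_minus inverse_le_1_iff)
qed auto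

lemma padic_abs_of_int_lt_1_iff: "padic_abs p (of_int n) < 1 \<longleftrightarrow> int p dvd n"
proof (cases "n = 0")
  case False
  have "padic_abs p (of_int n) = inverse (real p ^ multiplicity (int p) n)"
    using False by (simp add: padic_abs_of_int power_int_minus)
  also have "\<dots> < 1 \<longleftrightarrow> multiplicity (int p) n \<noteq> 0"
    using p_gt_1 by (cases "multiplicity (int p) n") (auto simp: inverse_less_1_iff one_less_power simp del: power_Suc)
  also have "\<dots> \<longleftrightarrow> int p dvd n"
    using False int_p by (simp add: multiplicity_eq_zero_iff prime_elem_multiplicity_eq_zero_iff)
  finally show ?thesis .
qed auto

lemma padic_abs_range: "x \<noteq> 0 \<Longrightarrow> \<exists>k. padic_abs p x = real p powi k"
  by (auto simp: padic_abs_def)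

lemma padic_abs_add_le_max: "padic_abs p (x + y) \<le> max (padic_abs p x) (padic_abs p y)"
proof (cases "x = 0 \<or> y = 0 \<or> x + y = 0")
  case False
  obtain a' b where x: "x = of_int a' / of_int b" "b > 0" by (rule rat_frac)
  obtain c' d where y: "y = of_int c' / of_int d" "d > 0" by (rule rat_frac)
  \<comment> \<open>a common denominator\<close>
  define a c e where "a = a' * d" and "c = c' * b" and "e = b * d"
  have e: "e > 0" using x y by (simp add: e_def)
  have eq: "x = of_int a / of_int e" "y = of_int c / of_int e" "x + y = of_int (a + c) / of_int e"
    using x y by (simp_all add: a_def c_def e_def field_simps)
  have nz: "a \<noteq> 0" "c \<noteq> 0" "a + c \<noteq> 0" using False eq by auto
  define m where "m = min (multiplicity (int p) a) (multiplicity (int p) c)"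
  have "int p ^ m dvd a + c"
    by (intro dvd_add multiplicity_dvd') (auto simp: m_def)
  then have "m \<le> multiplicity (int p) (a + c)"
    using nz int_p by (intro multiplicity_geI) (auto simp: prime_gt_1_int not_le)
  then have "real p powi (int (multiplicity (int p) e) - int (multiplicity (int p) (a + c))) \<le>
     real p powi (int (multiplicity (int p) e) - int m)"
    using p_gt_1 by (intro power_int_increasing) auto
  also have "\<dots> \<le> max (padic_abs p x) (padic_abs p y)"
    using padic_abs_frac[of a e] padic_abs_frac[of c e] nz e
    by (cases "multiplicity (int p) a \<le> multiplicity (int p) c")
      (simp_all add: m_def eq(1,2) min_def le_max_iff_disj del: padic_abs_divide)
  finally show ?thesis unfolding eq(3) using padic_abs_frac[of "a + c" e] nz e by simp
qed (auto simp: max_def)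

lemma padic_abs_diff_le_max: "padic_abs p (x - y) \<le> max (padic_abs p x) (padic_abs p y)"
  using padic_abs_add_le_max[of x "- y"] by simp

lemma padic_abs_add_le: "padic_abs p (x + y) \<le> padic_abs p x + padic_abs p y"
  using padic_abs_add_le_max[of x y] padic_abs_nonneg[of x] padic_abs_nonneg[of y] by linarith

lemma padic_abs_add_eq_max:
  assumes "padic_abs p x \<noteq> padic_abs p y"
  shows "padic_abs p (x + y) = max (padic_abs p x) (padic_abs p y)"
  using padic_abs_add_le_max[of x y] padic_abs_diff_le_max[of "x + y" y]
    padic_abs_diff_le_max[of "x + y" x] assms by auto

lemma padic_abs_lt_1:
  assumes "padic_abs p x < 1" shows "padic_abs p x \<le> 1 / real p"
proof (cases "x = 0")
  case False
  then obtain k where k: "padic_abs p x = real p powi k" using padic_abs_range by blast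
  have "k < 0"
  proof (rule ccontr)
    assume "\<not> k < 0"
    then have "real p powi k \<ge> 1" using p_gt_1 by (simp add: one_le_power_int)
    then show False using k assms by simp
  qed
  then have "real p powi k \<le> real p powi (-1)" using p_gt_1 by (intro power_int_increasing) auto
  then show ?thesis using k by (simp add: power_int_minus field_simps)
qed auto

text \<open>
  The residue field of the valuation ring of \<open>\<bar>\<cdot>\<bar>\<^sub>p\<close> on \<open>\<rat>\<close> is that of the integers: the denominator of
  a \<open>p\<close>-integral fraction is invertible modulo \<open>p\<close>.
\<close>

lemma padic_residue:
  assumes "padic_abs p x \<le> 1"
  obtains t :: int where "padic_abs p (x - of_int t) < 1"
proof -
  obtain a b where x: "x = of_int a / of_int b" "b > 0" "coprime a b" by (rule rat_frac)
  have b: "\<not> int p dvd b"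
  proof
    assume "int p dvd b"
    then have "\<not> int p dvd a" using x(3) int_p not_prime_unit coprime_common_divisor by blast
    then have "padic_abs p (of_int a) = 1"
      using padic_abs_of_int_le_1[of a] padic_abs_of_int_lt_1_iff[of a] by linarith
    moreover have "padic_abs p (of_int b) < 1" "padic_abs p (of_int b) > 0"
      using \<open>int p dvd b\<close> x padic_abs_of_int_lt_1_iff[of b] padic_abs_pos[of "of_int b"] by auto
    ultimately show False using assms x(1) by (simp add: field_simps)
  qed
  then have "coprime b (int p)" using int_p by (metis coprime_commute prime_imp_coprime)
  then obtain u where u: "[b * u = 1] (mod int p)" using cong_solve_coprime_int by blast
  have "[b * (u * a) = 1 * a] (mod int p)"
    using cong_scalar_right[OF u, of a] by (simp add: mult.assoc)
  then have d: "int p dvd a - b * (u * a)" by (metis cong_iff_dvd_diff cong_sym mult_1)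
  have "padic_abs p (of_int b) = 1"
    using padic_abs_of_int_le_1[of b] padic_abs_of_int_lt_1_iff[of b] b by linarith
  moreover have "x - of_int (u * a) = of_int (a - b * (u * a)) / of_int b"
    using x by (simp add: field_simps)
  ultimately have "padic_abs p (x - of_int (u * a)) < 1"
    using d padic_abs_of_int_lt_1_iff[of "a - b * (u * a)"] by simp
  then show ?thesis by (rule that)
qed

lemma padic_balanced_residue:
  assumes "padic_abs p x \<le> 1" "odd p"
  shows "\<exists>t::int. \<bar>t\<bar> \<le> (int p - 1) div 2 \<and> padic_abs p (x - of_int t) < 1"
proof -
  obtain t :: int where t: "padic_abs p (x - of_int t) < 1" using padic_residue assms by blast
  obtain h where h: "int p = 2 * h + 1" using assms(2) by (metis even_of_nat oddE)
  \<comment> \<open>the representative of \<open>t\<close> modulo \<open>p\<close> in the interval from \<open>-h\<close> to \<open>h\<close>\<close>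
  define s where "s = (t + h) mod int p - h"
  have "0 \<le> s + h" "s + h < int p" using p_gt_1 by (auto simp: s_def)
  then have "\<bar>s\<bar> \<le> h" using h by linarith
  moreover have "int p dvd t - s"
  proof -
    have "t - s = (t + h) - (t + h) mod int p" by (simp add: s_def)
    then show ?thesis by (simp add: minus_mod_eq_mult_div)
  qed
  then have "padic_abs p (of_int (t - s)) < 1" by (simp only: padic_abs_of_int_lt_1_iff)
  then have "padic_abs p ((x - of_int t) + of_int (t - s)) < 1"
    using t padic_abs_add_le_max[of "x - of_int t" "of_int (t - s)"] by linarith
  then have "padic_abs p (x - of_int s) < 1" by simp
  ultimately show ?thesis using h by auto
qed

end

section \<open>The ring \<open>\<int>[1/p]\<close>\<close>

definition p_rationals :: "nat \<Rightarrow> rat set" where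
  "p_rationals p = {x. \<exists>k. x * of_nat p ^ k \<in> \<int>}"

lemma p_rationals_of_int [simp]: "of_int n \<in> p_rationals p"
  by (auto simp: p_rationals_def intro!: exI[of _ 0])

lemma p_rationals_0 [simp]: "0 \<in> p_rationals p" and p_rationals_1 [simp]: "1 \<in> p_rationals p"
  and p_rationals_of_nat [simp]: "of_nat n \<in> p_rationals p"
  using p_rationals_of_int[of 0] p_rationals_of_int[of 1] p_rationals_of_int[of "int n"] by auto

lemma p_rationals_numeral [simp]: "numeral n \<in> p_rationals p"
  using p_rationals_of_nat[of "numeral n" p] by simp

lemma p_rationals_mult [simp]:
  assumes "x \<in> p_rationals p" "y \<in> p_rationals p"
  shows "x * y \<in> p_rationals p"
proof -
  obtain k l where "x * of_nat p ^ k \<in> \<int>" "y * of_nat p ^ l \<in> \<int>"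
    using assms by (auto simp: p_rationals_def)
  then have "(x * of_nat p ^ k) * (y * of_nat p ^ l) \<in> \<int>" by (rule Ints_mult)
  then have "(x * y) * of_nat p ^ (k + l) \<in> \<int>" by (simp add: power_add algebra_simps)
  then show ?thesis unfolding p_rationals_def by blast
qed

lemma p_rationals_add [simp]:
  assumes "x \<in> p_rationals p" "y \<in> p_rationals p"
  shows "x + y \<in> p_rationals p"
proof -
  obtain k l where "x * of_nat p ^ k \<in> \<int>" "y * of_nat p ^ l \<in> \<int>"
    using assms by (auto simp: p_rationals_def)
  then have "(x * of_nat p ^ k) * of_nat (p ^ l) + (y * of_nat p ^ l) * of_nat (p ^ k) \<in> \<int>"
    by (intro Ints_mult[of _ "of_nat _"] Ints_add Ints_of_nat)
  then have "(x + y) * of_nat p ^ (k + l) \<in> \<int>" by (simp add: power_add algebra_simps)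
  then show ?thesis unfolding p_rationals_def by blast
qed

lemma p_rationals_minus [simp]: "x \<in> p_rationals p \<Longrightarrow> - x \<in> p_rationals p"
  using p_rationals_mult[of "of_int (-1)" p x] p_rationals_of_int[of "-1" p] by simp

lemma p_rationals_diff [simp]:
  "x \<in> p_rationals p \<Longrightarrow> y \<in> p_rationals p \<Longrightarrow> x - y \<in> p_rationals p"
  using p_rationals_add[of x p "- y"] by simp

lemma p_rationals_divide [simp]:
  assumes "x \<in> p_rationals p" "p > 0" shows "x / of_nat p \<in> p_rationals p"
proof -
  obtain k where "x * of_nat p ^ k \<in> \<int>" using assms by (auto simp: p_rationals_def)
  then have "(x / of_nat p) * of_nat p ^ Suc k \<in> \<int>" using assms(2) by simp
  then show ?thesis unfolding p_rationals_def by blast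
qed

text \<open>
  The only denominators in \<open>\<int>[1/p]\<close> are powers of \<open>p\<close>, and \<open>p\<close>-integrality removes these.
\<close>

lemma p_rationals_integral:
  assumes "prime p" "x \<in> p_rationals p" "padic_abs p x \<le> 1"
  shows "x \<in> \<int>"
proof -
  obtain k where "x * of_nat p ^ k \<in> \<int>" using assms by (auto simp: p_rationals_def)
  then show ?thesis
  proof (induction k)
    case (Suc k)
    then obtain n where n: "x * of_nat p ^ Suc k = of_int n" by (auto elim: Ints_cases)
    have "padic_abs p (of_int n) = padic_abs p x * (1 / real p) ^ Suc k"
      unfolding n[symmetric] by (simp only: padic_abs_mult[OF assms(1)] padic_abs_power[OF assms(1)] padic_abs_p[OF assms(1)])
    also have "\<dots> \<le> (1 / real p) ^ Suc k"
      using assms(3) by (intro mult_left_le_one_le) (auto simp: padic_abs_nonneg[OF assms(1)])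
    also have "\<dots> < 1" using p_gt_1[OF assms(1)] by (intro power_Suc_less_one) auto
    finally obtain m where m: "n = int p * m" using padic_abs_of_int_lt_1_iff[OF assms(1)] by blast
    have "x * of_nat p ^ k = of_int m"
      using n m p_gt_1[OF assms(1)] by (simp add: algebra_simps)
    then show ?case using Suc.IH by simp
  qed simp
qed

lemma half_not_p_rational:
  assumes "odd p" shows "1 / 2 \<notin> p_rationals p"
proof
  assume "1 / 2 \<in> p_rationals p"
  then obtain k n where "1 / 2 * of_nat p ^ k = (of_int n :: rat)"
    by (auto simp: p_rationals_def elim: Ints_cases)
  then have "(of_int (int p ^ k) :: rat) = of_int (2 * n)" by simp
  then have "int p ^ k = 2 * n" by (simp only: of_int_eq_iff)
  then have "even (int p ^ k)" by simp
  then show False using assms by simp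
qed

section \<open>Rational points of the \<open>p\<close>-adic quaternion algebra\<close>

lemma padic_cauchy_ring_simps:
  "X \<in> carrier (padic_cauchy_ring p) \<longleftrightarrow>
     (\<forall>e>0. \<exists>N. \<forall>m\<ge>N. \<forall>n\<ge>N. padic_abs p (X m - X n) < e)"
  "X \<otimes>\<^bsub>padic_cauchy_ring p\<^esub> Y = (\<lambda>n. X n * Y n)"
  "X \<oplus>\<^bsub>padic_cauchy_ring p\<^esub> Y = (\<lambda>n. X n + Y n)"
  "\<one>\<^bsub>padic_cauchy_ring p\<^esub> = (\<lambda>_. 1)" "\<zero>\<^bsub>padic_cauchy_ring p\<^esub> = (\<lambda>_. 0)"
  by (simp_all add: padic_cauchy_ring_def)

context
  fixes p :: nat
  assumes p: "prime p"
begin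

lemma padic_cauchy_bounded:
  assumes "X \<in> carrier (padic_cauchy_ring p)"
  obtains M N where "M > 0" "\<And>n. n \<ge> N \<Longrightarrow> padic_abs p (X n) \<le> M"
proof -
  obtain N where N: "\<And>m n. m \<ge> N \<Longrightarrow> n \<ge> N \<Longrightarrow> padic_abs p (X m - X n) < 1"
    using assms unfolding padic_cauchy_ring_simps by (metis zero_less_one)
  show ?thesis
  proof (rule that)
    show "padic_abs p (X N) + 1 > 0" using padic_abs_nonneg[OF p, of "X N"] by linarith
    fix n assume "n \<ge> N"
    then show "padic_abs p (X n) \<le> padic_abs p (X N) + 1"
      using N[of n N] padic_abs_add_le[OF p, of "X n - X N" "X N"] by simp
  qed
qed

lemma padic_cauchy_add:
  assumes "X \<in> carrier (padic_cauchy_ring p)" "Y \<in> carrier (padic_cauchy_ring p)"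
  shows "(\<lambda>n. X n + Y n) \<in> carrier (padic_cauchy_ring p)"
  unfolding padic_cauchy_ring_simps
proof (intro allI impI)
  fix e :: real assume "e > 0"
  then have "e / 2 > 0" by simp
  then obtain N1 N2 where
    N1: "\<And>m n. m \<ge> N1 \<Longrightarrow> n \<ge> N1 \<Longrightarrow> padic_abs p (X m - X n) < e / 2" and
    N2: "\<And>m n. m \<ge> N2 \<Longrightarrow> n \<ge> N2 \<Longrightarrow> padic_abs p (Y m - Y n) < e / 2"
    using assms unfolding padic_cauchy_ring_simps by meson
  have "padic_abs p (X m + Y m - (X n + Y n)) < e" if "m \<ge> max N1 N2" "n \<ge> max N1 N2" for m n
    using N1[of m n] N2[of m n] that padic_abs_add_le[OF p, of "X m - X n" "Y m - Y n"]
    by (simp add: algebra_simps)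
  then show "\<exists>N. \<forall>m\<ge>N. \<forall>n\<ge>N. padic_abs p (X m + Y m - (X n + Y n)) < e" by blast
qed

lemma padic_cauchy_mult:
  assumes "X \<in> carrier (padic_cauchy_ring p)" "Y \<in> carrier (padic_cauchy_ring p)"
  shows "(\<lambda>n. X n * Y n) \<in> carrier (padic_cauchy_ring p)"
  unfolding padic_cauchy_ring_simps
proof (intro allI impI)
  fix e :: real assume e: "e > 0"
  obtain M1 K1 where 1: "M1 > 0" "\<And>n. n \<ge> K1 \<Longrightarrow> padic_abs p (X n) \<le> M1"
    using padic_cauchy_bounded[OF assms(1)] by blast
  obtain M2 K2 where 2: "M2 > 0" "\<And>n. n \<ge> K2 \<Longrightarrow> padic_abs p (Y n) \<le> M2"
    using padic_cauchy_bounded[OF assms(2)] by blast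
  have "e / (2 * M2) > 0" "e / (2 * M1) > 0" using e 1 2 by auto
  then obtain N1 N2 where
    N1: "\<And>m n. m \<ge> N1 \<Longrightarrow> n \<ge> N1 \<Longrightarrow> padic_abs p (X m - X n) < e / (2 * M2)" and
    N2: "\<And>m n. m \<ge> N2 \<Longrightarrow> n \<ge> N2 \<Longrightarrow> padic_abs p (Y m - Y n) < e / (2 * M1)"
    using assms unfolding padic_cauchy_ring_simps by meson
  let ?N = "max (max K1 K2) (max N1 N2)"
  have "padic_abs p (X m * Y m - X n * Y n) < e" if mn: "m \<ge> ?N" "n \<ge> ?N" for m n
  proof -
    have "padic_abs p (X m * Y m - X n * Y n) \<le>
        padic_abs p (X m) * padic_abs p (Y m - Y n) + padic_abs p (Y n) * padic_abs p (X m - X n)"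
      using padic_abs_add_le[OF p, of "X m * (Y m - Y n)" "Y n * (X m - X n)"]
      unfolding padic_abs_mult[OF p] by (simp add: algebra_simps)
    also have "\<dots> \<le> M1 * padic_abs p (Y m - Y n) + M2 * padic_abs p (X m - X n)"
      using 1 2 mn by (intro add_mono mult_right_mono padic_abs_nonneg[OF p]) auto
    also have "\<dots> < M1 * (e / (2 * M1)) + M2 * (e / (2 * M2))"
      using 1 2 mn N1 N2 by (intro add_strict_mono mult_strict_left_mono) auto
    also have "\<dots> = e" using 1 2 by simp
    finally show ?thesis .
  qed
  then show "\<exists>N. \<forall>m\<ge>N. \<forall>n\<ge>N. padic_abs p (X m * Y m - X n * Y n) < e" by blast
qed

lemma padic_cauchy_const [simp]: "(\<lambda>_. x) \<in> carrier (padic_cauchy_ring p)"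
  using p by (simp add: padic_cauchy_ring_simps)

lemma padic_cauchy_minus:
  "X \<in> carrier (padic_cauchy_ring p) \<Longrightarrow> (\<lambda>n. - X n) \<in> carrier (padic_cauchy_ring p)"
  using padic_cauchy_mult[OF padic_cauchy_const[of "-1"]] by simp

lemma cring_padic_cauchy: "cring (padic_cauchy_ring p)"
proof (rule cringI)
  show "abelian_group (padic_cauchy_ring p)"
  proof (rule abelian_groupI)
    fix X assume "X \<in> carrier (padic_cauchy_ring p)"
    then show "\<exists>Y\<in>carrier (padic_cauchy_ring p). Y \<oplus>\<^bsub>padic_cauchy_ring p\<^esub> X = \<zero>\<^bsub>padic_cauchy_ring p\<^esub>"
      using padic_cauchy_minus by (intro bexI[of _ "\<lambda>n. - X n"]) (auto simp: padic_cauchy_ring_simps(2-))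
  qed (auto simp: padic_cauchy_ring_simps(2-) intro: padic_cauchy_add)
  show "comm_monoid (padic_cauchy_ring p)"
    by (rule comm_monoidI) (auto simp: padic_cauchy_ring_simps(2-) intro: padic_cauchy_mult)
qed (auto simp: padic_cauchy_ring_simps(2-) algebra_simps)

lemma padic_cauchy_a_inv:
  assumes "X \<in> carrier (padic_cauchy_ring p)"
  shows "\<ominus>\<^bsub>padic_cauchy_ring p\<^esub> X = (\<lambda>n. - X n)"
proof -
  interpret cring "padic_cauchy_ring p" by (rule cring_padic_cauchy)
  show ?thesis
    by (rule minus_equality) (use assms padic_cauchy_minus in \<open>auto simp: padic_cauchy_ring_simps(2-)\<close>)
qed

lemma padic_null_cauchy: "padic_null p \<subseteq> carrier (padic_cauchy_ring p)"
proof
  fix X assume "X \<in> padic_null p"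
  then have lim: "(\<lambda>n. padic_abs p (X n)) \<longlonglongrightarrow> 0" by (simp add: padic_null_def)
  show "X \<in> carrier (padic_cauchy_ring p)"
    unfolding padic_cauchy_ring_simps
  proof (intro allI impI)
    fix e :: real assume "e > 0"
    then obtain N where N: "\<And>n. n \<ge> N \<Longrightarrow> padic_abs p (X n) < e"
      using order_tendstoD(2)[OF lim] unfolding eventually_sequentially by meson
    have "padic_abs p (X m - X n) < e" if "m \<ge> N" "n \<ge> N" for m n
      using padic_abs_diff_le_max[OF p, of "X m" "X n"] N[of m] N[of n] that by linarith
    then show "\<exists>N. \<forall>m\<ge>N. \<forall>n\<ge>N. padic_abs p (X m - X n) < e" by blast
  qed
qed

lemma padic_null_add:
  assumes "X \<in> padic_null p" "Y \<in> padic_null p"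
  shows "(\<lambda>n. X n + Y n) \<in> padic_null p"
proof -
  have "(\<lambda>n. padic_abs p (X n) + padic_abs p (Y n)) \<longlonglongrightarrow> 0"
    using assms tendsto_add[of "\<lambda>n. padic_abs p (X n)" 0 sequentially "\<lambda>n. padic_abs p (Y n)" 0]
    by (simp add: padic_null_def)
  then have "(\<lambda>n. padic_abs p (X n + Y n)) \<longlonglongrightarrow> 0"
    by (rule tendsto_sandwich[OF _ _ tendsto_const, rotated 2])
      (use p in \<open>auto simp: padic_abs_nonneg padic_abs_add_le\<close>)
  then show ?thesis by (simp add: padic_null_def)
qed

text \<open>
  A Cauchy sequence is eventually bounded, hence multiplication by it preserves null sequences.
\<close>

lemma padic_null_mult:
  assumes "X \<in> padic_null p" "Y \<in> carrier (padic_cauchy_ring p)"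
  shows "(\<lambda>n. X n * Y n) \<in> padic_null p"
proof -
  obtain M N where M: "M > 0" "\<And>n. n \<ge> N \<Longrightarrow> padic_abs p (Y n) \<le> M"
    using padic_cauchy_bounded[OF assms(2)] by blast
  have "(\<lambda>n. padic_abs p (X n) * M) \<longlonglongrightarrow> 0"
    using assms(1) tendsto_mult_right[of "\<lambda>n. padic_abs p (X n)" 0 sequentially M]
    by (simp add: padic_null_def)
  then have "(\<lambda>n. padic_abs p (X n * Y n)) \<longlonglongrightarrow> 0"
  proof (rule tendsto_sandwich[OF _ _ tendsto_const, rotated 2])
    show "\<forall>\<^sub>F n in sequentially. padic_abs p (X n * Y n) \<le> padic_abs p (X n) * M"
      using M(2) unfolding eventually_sequentially
      by (intro exI[of _ N]) (auto simp: padic_abs_mult[OF p] intro!: mult_left_mono padic_abs_nonneg[OF p])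
  qed (use p in \<open>auto simp: padic_abs_nonneg\<close>)
  then show ?thesis by (simp add: padic_null_def)
qed

lemma ideal_padic_null: "ideal (padic_null p) (padic_cauchy_ring p)"
proof (rule idealI)
  interpret cring "padic_cauchy_ring p" by (rule cring_padic_cauchy)
  show "ring (padic_cauchy_ring p)" by (rule ring_axioms)
  show "subgroup (padic_null p) (add_monoid (padic_cauchy_ring p))"
  proof (rule subgroup.intro)
    fix X assume X: "X \<in> padic_null p"
    then have "inv\<^bsub>add_monoid (padic_cauchy_ring p)\<^esub> X = (\<lambda>n. - X n)"
      using padic_cauchy_a_inv padic_null_cauchy by (auto simp: a_inv_def)
    then show "inv\<^bsub>add_monoid (padic_cauchy_ring p)\<^esub> X \<in> padic_null p"
      using padic_null_mult[OF X padic_cauchy_const[of "-1"]] by simp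
  qed (use padic_null_cauchy padic_null_add in \<open>auto simp: padic_cauchy_ring_simps(2-)\<close>,
      use p in \<open>auto simp: padic_null_def padic_abs_0\<close>)
next
  fix X Y assume "X \<in> padic_null p" "Y \<in> carrier (padic_cauchy_ring p)"
  then show "Y \<otimes>\<^bsub>padic_cauchy_ring p\<^esub> X \<in> padic_null p" "X \<otimes>\<^bsub>padic_cauchy_ring p\<^esub> Y \<in> padic_null p"
    using padic_null_mult[of X Y] by (auto simp: padic_cauchy_ring_simps(2-) mult.commute)
qed

lemma cring_padic_field: "cring (padic_field p)"
  unfolding padic_field_def
  by (rule ideal.quotient_is_cring[OF ideal_padic_null cring_padic_cauchy])

lemma padic_of_rat_hom: "ring_hom_cring rational_ring (padic_field p) (padic_of_rat p)"
proof -
  have "(\<lambda>x _. x) \<in> ring_hom rational_ring (padic_cauchy_ring p)"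
    by (rule ring_hom_memI) (auto simp: padic_cauchy_ring_simps(2-) rational_ring_simps)
  from ring_hom_trans[OF this ideal.rcos_ring_hom[OF ideal_padic_null]]
  have "padic_of_rat p \<in> ring_hom rational_ring (padic_field p)"
    by (simp add: padic_field_def padic_of_rat_def[abs_def] o_def)
  then show ?thesis
    by (rule ring_hom_cringI[OF cring_rational_ring cring_padic_field])
qed

text \<open>
  A \<open>p\<close>-adic number that comes from a rational \<open>x\<close> is the set of sequences converging \<open>p\<close>-adically
  to \<open>x\<close>.
\<close>

lemma padic_of_rat_coset: "X \<in> padic_of_rat p x \<longleftrightarrow> (\<lambda>n. X n - x) \<in> padic_null p"
proof -
  have "X \<in> padic_of_rat p x \<longleftrightarrow> (\<exists>h\<in>padic_null p. X = (\<lambda>n. h n + x))"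
    by (simp add: padic_of_rat_def a_r_coset_def' padic_cauchy_ring_simps(2-))
  also have "\<dots> \<longleftrightarrow> (\<lambda>n. X n - x) \<in> padic_null p"
  proof
    assume "(\<lambda>n. X n - x) \<in> padic_null p"
    then show "\<exists>h\<in>padic_null p. X = (\<lambda>n. h n + x)"
      by (intro bexI[of _ "\<lambda>n. X n - x"]) auto
  qed auto
  finally show ?thesis .
qed

lemma const_in_padic_of_rat: "(\<lambda>_. y) \<in> padic_of_rat p x \<longleftrightarrow> x = y"
  by (auto simp: padic_of_rat_coset padic_null_def LIMSEQ_const_iff padic_abs_eq_0_iff[OF p])

lemma inj_padic_of_rat: "inj (padic_of_rat p)"
  by (rule injI) (metis const_in_padic_of_rat)

text \<open>
  The limit that defines the norm exists by the reverse triangle inequality, and it can be read off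
  from the constant sequence.
\<close>

lemma padic_norm_of_rat: "padic_norm p (padic_of_rat p x) = padic_abs p x"
  unfolding padic_norm_def
proof (rule the_equality)
  show "\<forall>X\<in>padic_of_rat p x. (\<lambda>n. padic_abs p (X n)) \<longlonglongrightarrow> padic_abs p x"
  proof
    fix X assume "X \<in> padic_of_rat p x"
    then have lim: "(\<lambda>n. padic_abs p (X n - x)) \<longlonglongrightarrow> 0"
      by (simp add: padic_of_rat_coset padic_null_def)
    have "\<bar>padic_abs p (X n) - padic_abs p x\<bar> \<le> padic_abs p (X n - x)" for n
      using padic_abs_add_le[OF p, of "X n - x" x] padic_abs_add_le[OF p, of "x - X n" "X n"]
        padic_abs_diff_commute[OF p, of x "X n"] by simp
    then have "(\<lambda>n. \<bar>padic_abs p (X n) - padic_abs p x\<bar>) \<longlonglongrightarrow> 0"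
      by (intro tendsto_sandwich[OF _ _ tendsto_const lim]) auto
    then have "(\<lambda>n. padic_abs p (X n) - padic_abs p x) \<longlonglongrightarrow> 0"
      by (rule tendsto_rabs_zero_cancel)
    then show "(\<lambda>n. padic_abs p (X n)) \<longlonglongrightarrow> padic_abs p x" by (simp add: LIM_zero_iff)
  qed
next
  fix t assume "\<forall>X\<in>padic_of_rat p x. (\<lambda>n. padic_abs p (X n)) \<longlonglongrightarrow> t"
  then have "(\<lambda>n::nat. padic_abs p x) \<longlonglongrightarrow> t" by (rule bspec) (simp add: const_in_padic_of_rat)
  then show "t = padic_abs p x" by (simp add: LIMSEQ_const_iff)
qed

lemma quat_embed_hom: "ring_hom_ring (quat_alg_rat a b) (quat_alg_padic p a b) (quat_embed p)"
  unfolding quat_alg_padic_def quat_embed_def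
  by (rule ring_hom_cring.map_quat_hom[OF padic_of_rat_hom]) (auto simp: rational_ring_simps)

lemma inj_quat_embed: "inj (quat_embed p)"
  unfolding quat_embed_def by (rule quat.inj_map[OF inj_padic_of_rat])

lemma quat_embed_minus:
  "quat_embed p x \<ominus>\<^bsub>quat_alg_padic p a b\<^esub> quat_embed p y = quat_embed p (x \<ominus>\<^bsub>quat_alg_rat a b\<^esub> y)"
proof -
  interpret ring_hom_ring "quat_alg_rat a b" "quat_alg_padic p a b" "quat_embed p"
    by (rule quat_embed_hom)
  show ?thesis by (simp add: quat_rat.minus_eq S.minus_eq quat_alg_rat_simps(1))
qed

lemma quat_abs_embed:
  "quat_abs p a b (quat_embed p x) = sqrt (padic_abs p (quat_nrd rational_ring a b x))"
  using ring_hom_cring.map_quat_nrd[OF padic_of_rat_hom, of a b x]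
  by (simp add: quat_abs_def quat_embed_def padic_norm_of_rat rational_ring_simps quat_alg_simps)

text \<open>
  The inverse in \<open>B \<otimes> \<rat>\<^sub>p\<close> is specified only by its defining equations, so it is enough that the ring
  homomorphism \<open>B \<rightarrow> B \<otimes> \<rat>\<^sub>p\<close> transports these.
\<close>

lemma quat_embed_inv:
  assumes "x \<otimes>\<^bsub>quat_alg_rat a b\<^esub> y = \<one>\<^bsub>quat_alg_rat a b\<^esub>" "y \<otimes>\<^bsub>quat_alg_rat a b\<^esub> x = \<one>\<^bsub>quat_alg_rat a b\<^esub>"
  shows "inv\<^bsub>quat_alg_padic p a b\<^esub> (quat_embed p x) = quat_embed p y"
proof -
  interpret ring_hom_ring "quat_alg_rat a b" "quat_alg_padic p a b" "quat_embed p"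
    by (rule quat_embed_hom)
  have "quat_embed p y = inv\<^bsub>quat_alg_padic p a b\<^esub> (quat_embed p x)"
    by (rule S.inv_unique') (use assms in \<open>auto simp: quat_alg_rat_simps(1) simp flip: hom_mult\<close>)
  then show ?thesis by simp
qed

end

section \<open>Anisotropy of the norm form\<close>

text \<open>
  By Gauss's lemma: doubling maps exactly \<open>2k + 1\<close> of the residues \<open>1, \<dots>, 4k + 1\<close> into the upper half
  of the residues modulo \<open>p = 8k + 3\<close>.
\<close>

lemma Legendre_2_mod_8:
  assumes "prime p" "[p = 3] (mod 8)"
  shows "Legendre 2 (int p) = -1"
proof -
  obtain k where k: "p = 8 * k + 3"
    using assms(2) by (auto simp: cong_def) (metis mod_div_decomp mult.commute)
  interpret GAUSS p 2
    by unfold_locales (use assms k in \<open>auto simp: cong_def\<close>)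
  have "E = (\<lambda>x. 2 * x) ` {2 * int k + 1..4 * int k + 1}"
    unfolding E_def C_def B_def A_def using k by (auto simp: image_iff)
  then have "card E = 2 * k + 1"
    by (simp add: card_image inj_on_def)
  then show ?thesis using gauss_lemma by simp
qed

text \<open>
  If \<open>q \<equiv> 1 (mod 4)\<close> this is quadratic reciprocity; if \<open>q = 2\<close> it is the supplementary law.
\<close>

lemma special_nonresidue:
  assumes "prime p" "p \<ge> 3" "prime q"
    and "([q = 1] (mod 4) \<and> Legendre (int p) (int q) = -1) \<or> (q = 2 \<and> [p = 3] (mod 8))"
  shows "\<not> QuadRes (int p) (int q)"
proof -
  have "Legendre (int q) (int p) = -1"
    using assms(4)
  proof
    assume q: "[q = 1] (mod 4) \<and> Legendre (int p) (int q) = -1"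
    then have "q \<noteq> 2" by (auto simp: cong_def)
    then have q2: "2 < q" using assms(3) prime_ge_2_nat[of q] by linarith
    have ne: "p \<noteq> q" using q by (auto simp: Legendre_def cong_def split: if_splits)
    have "q mod 4 = 1" using q by (simp add: cong_def)
    then have "4 dvd q - 1" by presburger
    then have "even ((q - 1) div 2)" by auto
    then have "even ((p - 1) div 2 * ((q - 1) div 2))" by simp
    then show ?thesis
      using Quadratic_Reciprocity[of p q] assms q q2 ne by (auto simp: minus_one_power_iff)
  qed (use Legendre_2_mod_8 assms in auto)
  then show ?thesis by (auto simp: Legendre_def split: if_splits)
qed

context
  fixes p q :: nat
  assumes p: "prime p" and nonres: "\<not> QuadRes (int p) (int q)"
begin

lemma nonresidue_not_dvd: "\<not> int p dvd t\<^sup>2 - int q"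
  using nonres by (auto simp: QuadRes_def cong_iff_dvd_diff)

lemma padic_abs_nonresidue: "padic_abs p (of_nat q) = 1"
proof -
  have "\<not> int p dvd int q" using nonresidue_not_dvd[of 0] by simp
  then show ?thesis
    using padic_abs_of_int_le_1[OF p, of "int q"] padic_abs_of_int_lt_1_iff[OF p, of "int q"] by simp
qed

text \<open>
  This is the norm form of the unramified quadratic extension of \<open>\<rat>\<^sub>p\<close>.  After division by the
  larger coordinate it suffices to see that \<open>u\<^sup>2 - q\<close> is a unit for every \<open>p\<close>-integral \<open>u\<close>; modulo \<open>p\<close>
  this says that \<open>q\<close> is not a square.
\<close>

lemma padic_abs_nrd_unramified:
  "padic_abs p (x * x - of_nat q * (y * y)) = (max (padic_abs p x) (padic_abs p y))\<^sup>2"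
proof (cases "padic_abs p x \<le> padic_abs p y")
  case True
  show ?thesis
  proof (cases "y = 0")
    case True
    with \<open>padic_abs p x \<le> padic_abs p y\<close> have "padic_abs p x = 0"
      using padic_abs_nonneg[OF p, of x] by (simp add: padic_abs_0[OF p])
    then have "x = 0" using padic_abs_eq_0_iff[OF p] by blast
    with True show ?thesis by (simp add: padic_abs_0[OF p])
  next
    case False
    define u where "u = x / y"
    have "padic_abs p u \<le> 1"
      using True padic_abs_pos[OF p False] by (simp add: u_def padic_abs_divide[OF p])
    then obtain t :: int where t: "padic_abs p (u - of_int t) < 1"
      using padic_residue[OF p] by blast
    have "padic_abs p (u + of_int t) \<le> 1"
      using padic_abs_add_le_max[OF p, of u "of_int t"] padic_abs_of_int_le_1[OF p, of t]
        \<open>padic_abs p u \<le> 1\<close> by linarith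
    then have "padic_abs p ((u - of_int t) * (u + of_int t)) < 1"
      using t padic_abs_nonneg[OF p] unfolding padic_abs_mult[OF p]
      by (smt (verit) mult_left_le)
    moreover have "padic_abs p (of_int (t\<^sup>2 - int q)) = 1"
      using nonresidue_not_dvd[of t] padic_abs_of_int_le_1[OF p, of "t\<^sup>2 - int q"]
        padic_abs_of_int_lt_1_iff[OF p, of "t\<^sup>2 - int q"] by linarith
    ultimately have "padic_abs p ((u - of_int t) * (u + of_int t) + of_int (t\<^sup>2 - int q)) = 1"
      by (subst padic_abs_add_eq_max[OF p]) auto
    moreover have "(u - of_int t) * (u + of_int t) + of_int (t\<^sup>2 - int q) = u * u - of_nat q"
      by (simp add: algebra_simps power2_eq_square)
    ultimately have "padic_abs p (u * u - of_nat q) = 1" by (simp only:)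
    moreover have "x * x - of_nat q * (y * y) = (u * u - of_nat q) * (y * y)"
      using False by (simp add: u_def field_simps)
    ultimately show ?thesis
      using True by (simp add: padic_abs_mult[OF p] power2_eq_square max_def)
  qed
next
  case False
  have "padic_abs p (of_nat q * (y * y)) < padic_abs p (x * x)"
    using False padic_abs_nonneg[OF p, of y]
    by (simp add: padic_abs_mult[OF p] padic_abs_nonresidue mult_strict_mono')
  then show ?thesis
    using False padic_abs_add_eq_max[OF p, of "x * x" "- (of_nat q * (y * y))"]
    by (simp add: padic_abs_minus[OF p] padic_abs_mult[OF p] power2_eq_square max_def)
qed

lemma padic_abs_max_range:
  assumes "x \<noteq> 0 \<or> y \<noteq> 0"
  shows "\<exists>k. max (padic_abs p x) (padic_abs p y) = real p powi k"
proof (cases "x = 0 \<or> y = 0")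
  case True
  then show ?thesis
    using assms padic_abs_range[OF p] padic_abs_nonneg[OF p]
    by (auto simp: padic_abs_0[OF p] max_absorb1 max_absorb2)
qed (use padic_abs_range[OF p] in \<open>auto simp: max_def\<close>)

text \<open>
  Write \<open>nrd x = A - p C\<close> with \<open>A\<close> and \<open>C\<close> norms from the unramified quadratic extension.  Nonzero
  such norms have even valuation, so \<open>A\<close> and \<open>p C\<close> have valuations of different parity and cannot cancel.
\<close>

lemma padic_abs_nrd:
  "padic_abs p (quat_nrd rational_ring (of_nat q) (of_nat p) x) =
     max ((max (padic_abs p (q1 x)) (padic_abs p (qi x)))\<^sup>2)
         ((max (padic_abs p (qj x)) (padic_abs p (qij x)))\<^sup>2 / real p)"
proof -
  define A C where "A = q1 x * q1 x - of_nat q * (qi x * qi x)"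
    and "C = qj x * qj x - of_nat q * (qij x * qij x)"
  have A: "padic_abs p A = (max (padic_abs p (q1 x)) (padic_abs p (qi x)))\<^sup>2"
    and C: "padic_abs p C = (max (padic_abs p (qj x)) (padic_abs p (qij x)))\<^sup>2"
    unfolding A_def C_def by (rule padic_abs_nrd_unramified)+
  have nrd: "quat_nrd rational_ring (of_nat q) (of_nat p) x = A + - (of_nat p * C)"
    by (simp add: quat_nrd_rat A_def C_def)
  have "padic_abs p (A + - (of_nat p * C)) = max (padic_abs p A) (padic_abs p (- (of_nat p * C)))"
  proof (cases "A = 0 \<or> C = 0")
    case True
    then show ?thesis
      using padic_abs_nonneg[OF p]
      by (auto simp: padic_abs_0[OF p] padic_abs_minus[OF p] padic_abs_mult[OF p] padic_abs_p[OF p]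
          max_absorb1 max_absorb2)
  next
    case False
    then have "q1 x \<noteq> 0 \<or> qi x \<noteq> 0" "qj x \<noteq> 0 \<or> qij x \<noteq> 0"
      by (auto simp: A_def C_def)
    then obtain k l where k: "padic_abs p A = (real p powi k)\<^sup>2" and l: "padic_abs p C = (real p powi l)\<^sup>2"
      using padic_abs_max_range[of "q1 x" "qi x"] padic_abs_max_range[of "qj x" "qij x"]
      unfolding A C by force
    have "padic_abs p A \<noteq> padic_abs p (- (of_nat p * C))"
    proof
      assume "padic_abs p A = padic_abs p (- (of_nat p * C))"
      then have "(real p powi k)\<^sup>2 = (real p powi l)\<^sup>2 / real p"
        by (simp add: k l padic_abs_minus[OF p] padic_abs_mult[OF p] padic_abs_p[OF p])
      moreover have "(real p powi i)\<^sup>2 = real p powi (2 * i)" for i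
        unfolding power2_eq_square mult_2[of i] by (rule power_int_add[symmetric]) (use p_gt_1[OF p] in auto)
      ultimately have "real p powi (2 * k) = real p powi (2 * l) / real p" by (simp only:)
      moreover have "real p powi (2 * k + 1) = real p powi (2 * k) * real p"
        by (rule power_int_add_1) (use p_gt_1[OF p] in auto)
      ultimately have "real p powi (2 * k + 1) = real p powi (2 * l)"
        using p_gt_1[OF p] by simp
      then have "2 * k + 1 = 2 * l"
        using p_gt_1[OF p] power_int_strict_increasing[of "2 * k + 1" "2 * l" "real p"]
          power_int_strict_increasing[of "2 * l" "2 * k + 1" "real p"] by linarith
      then show False by presburger
    qed
    then show ?thesis by (rule padic_abs_add_eq_max[OF p])
  qed
  then show ?thesis
    unfolding nrd by (simp add: A C padic_abs_minus[OF p] padic_abs_mult[OF p] padic_abs_p[OF p])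
qed

lemma nrd_eq_0_iff:
  "quat_nrd rational_ring (of_nat q) (of_nat p) x = 0 \<longleftrightarrow> x = Quat 0 0 0 0"
proof
  assume *: "quat_nrd rational_ring (of_nat q) (of_nat p) x = 0"
  have "padic_abs p (q1 x) = 0 \<and> padic_abs p (qi x) = 0 \<and> padic_abs p (qj x) = 0 \<and> padic_abs p (qij x) = 0"
  proof -
    have 0: "max ((max (padic_abs p (q1 x)) (padic_abs p (qi x)))\<^sup>2)
         ((max (padic_abs p (qj x)) (padic_abs p (qij x)))\<^sup>2 / real p) = 0"
      using * by (simp add: padic_abs_0[OF p] flip: padic_abs_nrd)
    have "(max (padic_abs p (q1 x)) (padic_abs p (qi x)))\<^sup>2 \<le> 0"
      "(max (padic_abs p (qj x)) (padic_abs p (qij x)))\<^sup>2 / real p \<le> 0"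
      unfolding 0[symmetric] by simp_all
    then have "max (padic_abs p (q1 x)) (padic_abs p (qi x)) = 0"
      "max (padic_abs p (qj x)) (padic_abs p (qij x)) = 0"
      using p_gt_1[OF p] by (auto simp: divide_le_0_iff)
    then show ?thesis
      using padic_abs_nonneg[OF p, of "q1 x"] padic_abs_nonneg[OF p, of "qi x"]
        padic_abs_nonneg[OF p, of "qj x"] padic_abs_nonneg[OF p, of "qij x"] by linarith
  qed
  then show "x = Quat 0 0 0 0"
    by (cases x) (simp add: padic_abs_eq_0_iff[OF p])
qed (simp add: quat_nrd_rat)

end

section \<open>Digit expansions and the floor function\<close>

text \<open>
  The power \<open>j\<^sup>l\<close>, computed from \<open>j\<^sup>2 = p\<close>.
\<close>

definition j_power :: "nat \<Rightarrow> int \<Rightarrow> rat quat" where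
  "j_power p l = (if even l then Quat (of_nat p powi (l div 2)) 0 0 0
                  else Quat 0 0 (of_nat p powi (l div 2)) 0)"

lemma mult_j_power:
  "x \<otimes>\<^bsub>quat_alg_rat a (of_nat p)\<^esub> j_power p l =
     (let P = of_nat p powi (l div 2) in
      if even l then Quat (P * q1 x) (P * qi x) (P * qj x) (P * qij x)
      else Quat (of_nat p * P * qj x) (of_nat p * P * qij x) (P * q1 x) (P * qi x))"
  by (simp add: j_power_def quat_alg_rat_simps quat_mult_rat Let_def)

lemma j_power_add_1:
  assumes "p > 0"
  shows "j_power p l \<otimes>\<^bsub>quat_alg_rat a (of_nat p)\<^esub> Quat 0 0 1 0 = j_power p (l + 1)"
proof -
  have 1: "Quat 0 0 1 0 = j_power p 1" by (simp add: j_power_def)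
  show ?thesis
  proof (cases "even l")
    case True
    then have "(l + 1) div 2 = l div 2" by presburger
    then show ?thesis unfolding 1 mult_j_power using True by (simp add: j_power_def)
  next
    case False
    then have "(l + 1) div 2 = l div 2 + 1" by presburger
    then show ?thesis unfolding 1 mult_j_power using False assms
      by (simp add: j_power_def power_int_add)
  qed
qed

lemma j_power_inverse:
  assumes "p > 0"
  shows "j_power p l \<otimes>\<^bsub>quat_alg_rat a (of_nat p)\<^esub> j_power p (- l) = \<one>\<^bsub>quat_alg_rat a (of_nat p)\<^esub>"
proof (cases "even l")
  case True
  then have "- l div 2 = - (l div 2)" by presburger
  then show ?thesis using True assms
    by (simp add: mult_j_power) (simp add: j_power_def power_int_minus quat_alg_rat_simps)
next
  case False
  then have e: "- l div 2 = - (l div 2) - 1" by presburger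
  have "(of_nat p :: rat) powi (- (l div 2) - 1) = inverse (of_nat p powi (l div 2)) / of_nat p"
    using assms by (simp add: power_int_diff power_int_minus)
  then show ?thesis using False assms
    by (simp add: mult_j_power) (simp add: j_power_def e quat_alg_rat_simps)
qed

lemma j_int_pow:
  assumes "p > 0"
  shows "Quat 0 0 1 0 [^]\<^bsub>quat_alg_rat a (of_nat p)\<^esub> l = j_power p l"
proof -
  have nat: "Quat 0 0 1 0 [^]\<^bsub>quat_alg_rat a (of_nat p)\<^esub> n = j_power p (int n)" for n :: nat
  proof (induction n)
    case (Suc n)
    then show ?case using j_power_add_1[OF assms, where l = "int n" and a = a] by (simp add: add.commute)
  qed (simp add: j_power_def quat_alg_rat_simps)
  show ?thesis
  proof (cases "l < 0")
    case True
    have "j_power p l = inv\<^bsub>quat_alg_rat a (of_nat p)\<^esub> (j_power p (- l))"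
      by (rule quat_rat.inv_unique')
        (use j_power_inverse[OF assms, where l = l and a = a] j_power_inverse[OF assms, where l = "- l" and a = a]
         in \<open>auto simp: quat_alg_rat_simps(1)\<close>)
    then show ?thesis using True by (simp add: int_pow_def2 nat)
  qed (simp add: int_pow_def2 nat)
qed

text \<open>
  Right multiplication by \<open>j\<^sup>-\<^sup>1 = j / p\<close>.
\<close>

definition div_j :: "nat \<Rightarrow> rat quat \<Rightarrow> rat quat" where
  "div_j p x = Quat (qj x) (qij x) (q1 x / of_nat p) (qi x / of_nat p)"

lemma div_j_mult_j_power:
  assumes "p > 0"
  shows "div_j p (x \<otimes>\<^bsub>quat_alg_rat a (of_nat p)\<^esub> j_power p l) =
    x \<otimes>\<^bsub>quat_alg_rat a (of_nat p)\<^esub> j_power p (l - 1)"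
proof (cases "even l")
  case True
  then have "(l - 1) div 2 = l div 2 - 1" by presburger
  then show ?thesis using True assms
    by (simp add: mult_j_power div_j_def Let_def power_int_diff)
next
  case False
  then have "(l - 1) div 2 = l div 2" by presburger
  then show ?thesis using False assms by (simp add: mult_j_power div_j_def Let_def)
qed

lemma div_j_mult_j_power':
  assumes "p > 0"
  shows "div_j p x \<otimes>\<^bsub>quat_alg_rat a (of_nat p)\<^esub> j_power p (l + 1) =
    x \<otimes>\<^bsub>quat_alg_rat a (of_nat p)\<^esub> j_power p l"
proof (cases "even l")
  case True
  then have "(l + 1) div 2 = l div 2" by presburger
  then show ?thesis using True assms
    by (simp add: mult_j_power div_j_def Let_def)
next
  case False
  then have "(l + 1) div 2 = l div 2 + 1" by presburger
  then show ?thesis using False assms by (simp add: mult_j_power div_j_def Let_def power_int_add)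
qed

lemma digit_sum_j:
  assumes "p > 0"
  shows "digit_sum a (of_nat p) (Quat 0 0 1 0) c r N =
   (let f = (\<lambda>l. c l \<otimes>\<^bsub>quat_alg_rat a (of_nat p)\<^esub> j_power p l) in
    Quat (\<Sum>l\<in>{r..N}. q1 (f l)) (\<Sum>l\<in>{r..N}. qi (f l))
         (\<Sum>l\<in>{r..N}. qj (f l)) (\<Sum>l\<in>{r..N}. qij (f l)))"
  unfolding digit_sum_def j_int_pow[OF assms] by (simp add: finsum_quat_alg_rat)

lemma digit_sum_empty: "r > N \<Longrightarrow> digit_sum a b u c r N = Quat 0 0 0 0"
  by (simp add: digit_sum_def quat_alg_rat_simps)

lemma digit_sum_Suc:
  assumes "p > 0" "r \<le> N + 1"
  shows "digit_sum a (of_nat p) (Quat 0 0 1 0) c r (N + 1) =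
    digit_sum a (of_nat p) (Quat 0 0 1 0) c r N \<oplus>\<^bsub>quat_alg_rat a (of_nat p)\<^esub>
      c (N + 1) \<otimes>\<^bsub>quat_alg_rat a (of_nat p)\<^esub> j_power p (N + 1)"
proof -
  have "{r..N + 1} = insert (N + 1) {r..N}" using assms(2) by auto
  then show ?thesis by (simp add: digit_sum_j[OF assms(1)] Let_def quat_alg_rat_simps(3) add.commute)
qed

text \<open>
  Horner's scheme \<open>\<Sum>\<^sub>l\<^sub>\<le>\<^sub>0 c\<^sub>l j\<^sup>l = c\<^sub>0 + (\<Sum>\<^sub>l\<^sub>\<le>\<^sub>0 c\<^sub>l\<^sub>-\<^sub>1 j\<^sup>l) j\<^sup>-\<^sup>1\<close>; it reduces statements about the values
  of the floor function to a single step.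
\<close>

lemma digit_sum_Horner:
  assumes "p > 0" "r \<le> 0"
  shows "digit_sum a (of_nat p) (Quat 0 0 1 0) c r 0 =
    c 0 \<oplus>\<^bsub>quat_alg_rat a (of_nat p)\<^esub>
      div_j p (digit_sum a (of_nat p) (Quat 0 0 1 0) (\<lambda>l. c (l - 1)) (r + 1) 0)"
proof -
  define f where "f l = c l \<otimes>\<^bsub>quat_alg_rat a (of_nat p)\<^esub> j_power p l" for l
  define g where "g l = c (l - 1) \<otimes>\<^bsub>quat_alg_rat a (of_nat p)\<^esub> j_power p l" for l
  have fg: "f (l - 1) = div_j p (g l)" for l
    by (simp add: f_def g_def div_j_mult_j_power[OF assms(1)])
  have f0: "f 0 = c 0" by (cases "c 0") (simp add: f_def mult_j_power)
  have split: "(\<Sum>l\<in>{r..0}. h l) = h 0 + (\<Sum>l\<in>{r + 1..0}. h (l - 1))" for h :: "int \<Rightarrow> rat"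
  proof -
    have "{r..0} = insert 0 {r..-1}" using assms(2) by auto
    then have "(\<Sum>l\<in>{r..0}. h l) = h 0 + (\<Sum>l\<in>{r..-1}. h l)" by simp
    also have "(\<Sum>l\<in>{r..-1}. h l) = (\<Sum>l\<in>{r + 1..0}. h (l - 1))"
      by (rule sum.reindex_bij_witness[of _ "\<lambda>l. l - 1" "\<lambda>l. l + 1"]) auto
    finally show ?thesis .
  qed
  show ?thesis
    unfolding digit_sum_j[OF assms(1)] f_def[symmetric] g_def[symmetric] Let_def split f0 fg
    by (simp add: quat_alg_rat_simps(3) div_j_def sum_divide_distrib)
qed

text \<open>
  Balanced digits keep a floor strictly below \<open>p/2\<close> in the coordinates of \<open>1\<close> and \<open>i\<close> (even powers of
  \<open>j\<close>), and strictly below \<open>1/2\<close> in those of \<open>j\<close> and \<open>ij\<close> (odd negative powers of \<open>j\<close>).  These are the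
  bounds that make floors unique.
\<close>

definition floor_values :: "nat \<Rightarrow> rat quat set" where
  "floor_values p = {x. q1 x \<in> p_rationals p \<and> qi x \<in> p_rationals p \<and> qj x \<in> p_rationals p \<and> qij x \<in> p_rationals p
    \<and> \<bar>q1 x\<bar> < of_nat p / 2 \<and> \<bar>qi x\<bar> < of_nat p / 2 \<and> \<bar>qj x\<bar> < 1 / 2 \<and> \<bar>qij x\<bar> < 1 / 2}"

text \<open>
  The bounds are stable under the Horner step, because \<open>(p - 1)/2 + 1/2 = p/2\<close> and \<open>(p/2)/p = 1/2\<close>.
\<close>

lemma floor_values_step:
  assumes "c \<in> special_digits p" "x \<in> floor_values p" "p > 0"
  shows "c \<oplus>\<^bsub>quat_alg_rat a b\<^esub> div_j p x \<in> floor_values p"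
proof -
  obtain s t :: int where c: "c = Quat (of_int s) (of_int t) 0 0"
    and st: "\<bar>s\<bar> \<le> (int p - 1) div 2" "\<bar>t\<bar> \<le> (int p - 1) div 2"
    using assms(1) by (auto simp: special_digits_def)
  have *: "\<bar>of_int s :: rat\<bar> \<le> (of_nat p - 1) / 2" if "\<bar>s\<bar> \<le> (int p - 1) div 2" for s
  proof -
    have "2 * \<bar>s\<bar> \<le> int p - 1" using that by linarith
    then have "(of_int (2 * \<bar>s\<bar>) :: rat) \<le> of_int (int p - 1)" by (simp only: of_int_le_iff)
    then show ?thesis by simp
  qed
  have low: "\<bar>of_int s + z\<bar> < (of_nat p :: rat) / 2" if "\<bar>z\<bar> < 1 / 2" "\<bar>s\<bar> \<le> (int p - 1) div 2" for s z
    using *[OF that(2)] that(1) abs_triangle_ineq[of "of_int s" z] by (simp add: diff_divide_distrib)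
  have high: "\<bar>z / of_nat p\<bar> < 1 / 2" if "\<bar>z\<bar> < of_nat p / 2" for z :: rat
    using that assms(3) by (simp add: abs_divide field_simps)
  show ?thesis
    using low[OF _ st(1)] low[OF _ st(2)] high assms(2,3)
    by (auto simp: c quat_alg_rat_simps(3) div_j_def floor_values_def)
qed

lemma digit_sum_floor_values:
  assumes "p > 0" "\<And>l. l \<ge> r \<Longrightarrow> c l \<in> special_digits p"
  shows "digit_sum a (of_nat p) (Quat 0 0 1 0) c r 0 \<in> floor_values p"
  using assms(2)
proof (induction "nat (1 - r)" arbitrary: r c)
  case 0
  then show ?case using assms(1) by (simp add: digit_sum_empty floor_values_def)
next
  case (Suc n)
  then have r: "r \<le> 0" by linarith
  have "digit_sum a (of_nat p) (Quat 0 0 1 0) (\<lambda>l. c (l - 1)) (r + 1) 0 \<in> floor_values p"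
    by (rule Suc.hyps) (use Suc in auto)
  then show ?case
    unfolding digit_sum_Horner[OF assms(1) r]
    using Suc.prems[of 0] r assms(1) by (intro floor_values_step) auto
qed

text \<open>
  The elements of \<open>B\<close> in the valuation ring of \<open>B \<otimes> \<rat>\<^sub>p\<close> when \<open>q\<close> is a non-residue modulo \<open>p\<close>.
\<close>

definition padic_integral :: "nat \<Rightarrow> rat quat set" where
  "padic_integral p = {x. padic_abs p (q1 x) \<le> 1 \<and> padic_abs p (qi x) \<le> 1 \<and>
     padic_abs p (qj x) \<le> 1 \<and> padic_abs p (qij x) \<le> 1}"

text \<open>
  The set \<open>O j\<close> for the valuation ring \<open>O\<close> of the preceding definition, that is, its elements of positive
  valuation.
\<close>

definition padic_radical :: "nat \<Rightarrow> rat quat set" where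
  "padic_radical p = {x. padic_abs p (q1 x) < 1 \<and> padic_abs p (qi x) < 1 \<and>
     padic_abs p (qj x) \<le> 1 \<and> padic_abs p (qij x) \<le> 1}"

context
  fixes p :: nat
  assumes p: "prime p"
begin

lemma p_pos: "p > 0"
  using p prime_gt_0_nat by blast

lemmas padic_simps = padic_abs_0[OF p] padic_abs_nonneg[OF p] padic_abs_mult[OF p]
  padic_abs_minus[OF p] padic_abs_divide[OF p] padic_abs_p[OF p] padic_abs_power[OF p]
  padic_abs_of_int_le_1[OF p] padic_abs_1[OF p]

lemma padic_abs_power_int: "padic_abs p (of_nat p powi k) = real p powi (- k)"
proof (cases k rule: int_cases2)
  case (nonneg n)
  then show ?thesis by (simp add: padic_simps power_int_minus power_divide field_simps)
next
  case (nonpos n)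
  then show ?thesis by (simp add: padic_simps power_int_minus padic_abs_inverse[OF p] power_divide field_simps)
qed

lemma padic_radical_add:
  assumes "x \<in> padic_radical p" "y \<in> padic_radical p"
  shows "x \<oplus>\<^bsub>quat_alg_rat a b\<^esub> y \<in> padic_radical p"
  using assms le_less_trans[OF padic_abs_add_le_max[OF p], of _ _ 1]
    order_trans[OF padic_abs_add_le_max[OF p], of _ _ 1]
  by (auto simp: padic_radical_def quat_alg_rat_simps(3))

lemma padic_radical_diff:
  assumes "x \<in> padic_radical p" "y \<in> padic_radical p"
  shows "x \<ominus>\<^bsub>quat_alg_rat a b\<^esub> y \<in> padic_radical p"
  using assms le_less_trans[OF padic_abs_diff_le_max[OF p], of _ _ 1]
    order_trans[OF padic_abs_diff_le_max[OF p], of _ _ 1]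
  by (auto simp: padic_radical_def quat_alg_rat_minus)

lemma digit_j_power_radical:
  assumes "c \<in> special_digits p" "l \<ge> 1"
  shows "c \<otimes>\<^bsub>quat_alg_rat a (of_nat p)\<^esub> j_power p l \<in> padic_radical p"
proof -
  obtain s t :: int where c: "c = Quat (of_int s) (of_int t) 0 0"
    using assms(1) by (auto simp: special_digits_def)
  define P :: rat where "P = of_nat p powi (l div 2)"
  have P: "padic_abs p P = real p powi (- (l div 2))"
    by (simp add: P_def padic_abs_power_int)
  have "padic_abs p P \<le> real p powi 0"
    unfolding P using p_gt_1[OF p] assms(2) by (intro power_int_increasing) auto
  then have 1: "padic_abs p P \<le> 1" by simp
  have 2: "padic_abs p P < 1" if "even l"
  proof -
    have "l div 2 \<ge> 1" using that assms(2) by presburger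
    then have "padic_abs p P < real p powi 0"
      unfolding P using p_gt_1[OF p] by (intro power_int_strict_increasing) auto
    then show ?thesis by simp
  qed
  have st: "padic_abs p (P * of_int s) \<le> padic_abs p P" for s
    using mult_left_mono[OF padic_abs_of_int_le_1[OF p, of s] padic_abs_nonneg[OF p, of P]]
    by (simp add: padic_simps)
  show ?thesis
    using 1 2 st[of s] st[of t]
    by (auto simp: mult_j_power c padic_radical_def padic_simps(1) P_def[symmetric] Let_def)
qed

lemma digit_sum_tail:
  assumes "\<And>l. l \<ge> r \<Longrightarrow> c l \<in> special_digits p"
  shows "digit_sum a (of_nat p) (Quat 0 0 1 0) c r (int n) \<ominus>\<^bsub>quat_alg_rat a (of_nat p)\<^esub>
     digit_sum a (of_nat p) (Quat 0 0 1 0) c r 0 \<in> padic_radical p"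
proof (induction n)
  case 0
  then show ?case by (simp add: quat_alg_rat_minus padic_radical_def padic_simps(1))
next
  case (Suc n)
  show ?case
  proof (cases "r \<le> int n + 1")
    case True
    have "c (int n + 1) \<otimes>\<^bsub>quat_alg_rat a (of_nat p)\<^esub> j_power p (int n + 1) \<in> padic_radical p"
      by (rule digit_j_power_radical) (use True assms in auto)
    from padic_radical_add[OF Suc this, of a "of_nat p"] show ?thesis
      using digit_sum_Suc[OF p_pos True, of a c]
      by (simp add: quat_alg_rat_simps(3) quat_alg_rat_minus algebra_simps)
  next
    case False
    then show ?thesis
      by (simp add: digit_sum_empty quat_alg_rat_minus padic_radical_def padic_simps(1))
  qed
qed

text \<open>
  For an element of \<open>B\<close> the convergence of a digit expansion is a statement about rational norms.
\<close>

lemma digit_expansion_embed: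
  "digit_expansion p (of_nat q) (of_nat p) u C (quat_embed p x) r c \<longleftrightarrow>
     (\<forall>l\<ge>r. c l \<in> C) \<and>
     (\<lambda>n. padic_abs p (quat_nrd rational_ring (of_nat q) (of_nat p)
        (x \<ominus>\<^bsub>quat_alg_rat (of_nat q) (of_nat p)\<^esub>
           digit_sum (of_nat q) (of_nat p) u c r (int n)))) \<longlonglongrightarrow> 0"
proof -
  have "(\<lambda>n. sqrt (f n)) \<longlonglongrightarrow> 0 \<longleftrightarrow> f \<longlonglongrightarrow> 0" if "\<And>n. f n \<ge> 0" for f :: "nat \<Rightarrow> real"
  proof
    assume "(\<lambda>n. sqrt (f n)) \<longlonglongrightarrow> 0"
    from tendsto_power[OF this, of 2] show "f \<longlonglongrightarrow> 0" using that by simp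
  next
    assume "f \<longlonglongrightarrow> 0"
    from tendsto_real_sqrt[OF this] show "(\<lambda>n. sqrt (f n)) \<longlonglongrightarrow> 0" by simp
  qed
  then show ?thesis
    by (simp add: digit_expansion_def quat_embed_minus[OF p] quat_abs_embed[OF p] padic_simps)
qed

text \<open>
  In the coordinates of \<open>1\<close> and \<open>i\<close> the difference lies in \<open>\<int>[1/p]\<close> and has positive valuation, so it is
  an integer divisible by \<open>p\<close>, of absolute value less than \<open>p\<close>.  In those of \<open>j\<close> and \<open>ij\<close> it is an
  integer of absolute value less than 1.
\<close>

lemma floor_unique:
  assumes "x \<in> floor_values p" "y \<in> floor_values p"
    "x \<ominus>\<^bsub>quat_alg_rat a b\<^esub> y \<in> padic_radical p"
  shows "x = y"
proof -
  have big: "u = v" if uv: "u \<in> p_rationals p" "v \<in> p_rationals p" "\<bar>u\<bar> < of_nat p / 2" "\<bar>v\<bar> < of_nat p / 2"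
    "padic_abs p (u - v) < 1" for u v :: rat
  proof -
    have "u - v \<in> \<int>" by (rule p_rationals_integral[OF p]) (use uv in auto)
    then obtain n where n: "u - v = of_int n" by (auto elim: Ints_cases)
    then obtain k where k: "n = int p * k"
      using uv(5) padic_abs_of_int_lt_1_iff[OF p] by auto
    have "\<bar>u - v\<bar> < of_nat p" using uv(3,4) by linarith
    then have "(of_int \<bar>n\<bar> :: rat) < of_int (int p)" using n by simp
    then have "\<bar>n\<bar> < int p" by (simp only: of_int_less_iff)
    then have "k = 0" using k p_pos by (simp add: abs_mult)
    then show ?thesis using n k by simp
  qed
  have small: "u = v" if uv: "u \<in> p_rationals p" "v \<in> p_rationals p" "\<bar>u\<bar> < 1 / 2" "\<bar>v\<bar> < 1 / 2"
    "padic_abs p (u - v) \<le> 1" for u v :: rat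
  proof -
    have "u - v \<in> \<int>" by (rule p_rationals_integral[OF p]) (use uv in auto)
    then obtain n where n: "u - v = of_int n" by (auto elim: Ints_cases)
    have "\<bar>u - v\<bar> < 1" using uv(3,4) by linarith
    then have "(of_int \<bar>n\<bar> :: rat) < of_int 1" using n by simp
    then have "n = 0" by (simp only: of_int_less_iff)
    then show ?thesis using n by simp
  qed
  show ?thesis
    by (rule quat.expand)
      (use assms in \<open>auto simp: floor_values_def padic_radical_def quat_alg_rat_minus intro: big small\<close>)
qed

lemma padic_integral_digit:
  assumes "odd p" "x \<in> padic_integral p"
  shows "\<exists>c\<in>special_digits p. x \<ominus>\<^bsub>quat_alg_rat a b\<^esub> c \<in> padic_radical p"
proof -
  obtain s t :: int where
    "\<bar>s\<bar> \<le> (int p - 1) div 2" "padic_abs p (q1 x - of_int s) < 1"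
    "\<bar>t\<bar> \<le> (int p - 1) div 2" "padic_abs p (qi x - of_int t) < 1"
    using padic_balanced_residue[OF p _ assms(1)] assms(2) unfolding padic_integral_def by blast
  then show ?thesis
    using assms
    by (intro bexI[of _ "Quat (of_int s) (of_int t) 0 0"])
      (auto simp: quat_alg_rat_minus padic_radical_def padic_integral_def special_digits_def)
qed

lemma div_j_radical:
  assumes "x \<in> padic_radical p" shows "div_j p x \<in> padic_integral p"
  using assms padic_abs_lt_1[OF p, of "q1 x"] padic_abs_lt_1[OF p, of "qi x"] p_pos
  by (auto simp: padic_radical_def padic_integral_def div_j_def padic_simps field_simps)

text \<open>
  The bound is asked for all large \<open>n\<close> so that one power of \<open>p\<close> serves all four coordinates.
\<close>

lemma padic_abs_scale:
  "\<exists>m. \<forall>n\<ge>m. padic_abs p (of_nat p powi int n * u) \<le> 1"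
proof -
  obtain m where m: "padic_abs p u < real p ^ m"
    using real_arch_pow[OF p_gt_1[OF p]] by blast
  have "padic_abs p (of_nat p powi int n * u) \<le> 1" if "n \<ge> m" for n
  proof -
    have "padic_abs p u \<le> real p ^ n"
      using m power_increasing[OF that, of "real p"] p_gt_1[OF p] by linarith
    then show ?thesis
      using p_pos by (simp only: padic_simps padic_abs_power_int) (simp add: power_int_minus field_simps)
  qed
  then show ?thesis by blast
qed

lemma padic_integral_scale:
  "\<exists>m. x \<otimes>\<^bsub>quat_alg_rat a (of_nat p)\<^esub> j_power p (2 * int m) \<in> padic_integral p"
proof -
  obtain m1 m2 m3 m4 where
    "\<forall>n\<ge>m1. padic_abs p (of_nat p powi int n * q1 x) \<le> 1"
    "\<forall>n\<ge>m2. padic_abs p (of_nat p powi int n * qi x) \<le> 1"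
    "\<forall>n\<ge>m3. padic_abs p (of_nat p powi int n * qj x) \<le> 1"
    "\<forall>n\<ge>m4. padic_abs p (of_nat p powi int n * qij x) \<le> 1"
    using padic_abs_scale[of "q1 x"] padic_abs_scale[of "qi x"] padic_abs_scale[of "qj x"]
      padic_abs_scale[of "qij x"] by blast
  moreover define n where "n = max (max m1 m2) (max m3 m4)"
  moreover define P :: rat where "P = of_nat p powi int n"
  ultimately have "Quat (P * q1 x) (P * qi x) (P * qj x) (P * qij x) \<in> padic_integral p"
    by (auto simp: padic_integral_def)
  moreover have "x \<otimes>\<^bsub>quat_alg_rat a (of_nat p)\<^esub> j_power p (2 * int n) =
      Quat (P * q1 x) (P * qi x) (P * qj x) (P * qij x)"
    by (simp add: mult_j_power P_def Let_def)
  ultimately show ?thesis by (intro exI[of _ n]) (simp only:)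
qed

lemma padic_abs_nrd_j_power:
  "padic_abs p (quat_nrd rational_ring a (of_nat p) (x \<otimes>\<^bsub>quat_alg_rat a (of_nat p)\<^esub> j_power p l)) =
     real p powi (- l) * padic_abs p (quat_nrd rational_ring a (of_nat p) x)"
proof -
  define P :: rat where "P = of_nat p powi (l div 2)"
  have P: "padic_abs p P = real p powi (- (l div 2))" by (simp add: P_def padic_abs_power_int)
  show ?thesis
  proof (cases "even l")
    case True
    then have "x \<otimes>\<^bsub>quat_alg_rat a (of_nat p)\<^esub> j_power p l = Quat (P * q1 x) (P * qi x) (P * qj x) (P * qij x)"
      by (simp add: mult_j_power P_def Let_def)
    then have "quat_nrd rational_ring a (of_nat p) (x \<otimes>\<^bsub>quat_alg_rat a (of_nat p)\<^esub> j_power p l) =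
        P * P * quat_nrd rational_ring a (of_nat p) x"
      by (simp add: quat_nrd_rat algebra_simps)
    moreover have "real p powi (- l) = real p powi (- (l div 2)) * real p powi (- (l div 2))"
    proof (subst power_int_add[symmetric])
      have "- l = - (l div 2) + - (l div 2)" using True by presburger
      then show "real p powi (- l) = real p powi (- (l div 2) + - (l div 2))" by simp
    qed (use p_pos in simp)
    ultimately show ?thesis by (simp only: padic_simps P)
  next
    case False
    then have "x \<otimes>\<^bsub>quat_alg_rat a (of_nat p)\<^esub> j_power p l =
        Quat (of_nat p * P * qj x) (of_nat p * P * qij x) (P * q1 x) (P * qi x)"
      by (simp add: mult_j_power P_def Let_def)
    then have "quat_nrd rational_ring a (of_nat p) (x \<otimes>\<^bsub>quat_alg_rat a (of_nat p)\<^esub> j_power p l) =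
        - (of_nat p * P * P * quat_nrd rational_ring a (of_nat p) x)"
      by (simp add: quat_nrd_rat algebra_simps)
    moreover have "real p powi (- l) = 1 / real p * real p powi (- (l div 2)) * real p powi (- (l div 2))"
    proof -
      have "- l = - (l div 2) + - (l div 2) - 1" using False by presburger
      then have "real p powi (- l) = real p powi (- (l div 2) + - (l div 2) - 1)" by simp
      also have "\<dots> = 1 / real p * real p powi (- (l div 2)) * real p powi (- (l div 2))"
        using p_pos by (subst power_int_diff, simp, subst power_int_add) auto
      finally show ?thesis .
    qed
    ultimately show ?thesis by (simp only: padic_simps P)
  qed
qed

context
  fixes q :: nat
  assumes odd_p: "odd p" and nonres: "\<not> QuadRes (int p) (int q)"
begin

text \<open>
  Convergence in norm forces convergence of the coordinates, by the formula for \<open>\<bar>nrd x\<bar>\<close>.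
\<close>

lemma small_nrd_radical:
  assumes "padic_abs p (quat_nrd rational_ring (of_nat q) (of_nat p) x) < 1 / real p"
  shows "x \<in> padic_radical p"
proof -
  let ?m = "max (padic_abs p (q1 x)) (padic_abs p (qi x))"
  let ?n = "max (padic_abs p (qj x)) (padic_abs p (qij x))"
  have "?m\<^sup>2 < 1 / real p" "?n\<^sup>2 / real p < 1 / real p"
    using assms unfolding padic_abs_nrd[OF p nonres] by auto
  moreover have "1 / real p < 1" using p_gt_1[OF p] by simp
  ultimately have "?m\<^sup>2 < 1" "?n\<^sup>2 < 1"
    using p_gt_1[OF p] by (linarith, simp add: divide_less_cancel)
  then have "?m\<^sup>2 < 1\<^sup>2" "?n\<^sup>2 < 1\<^sup>2" by simp_all
  then have "?m < 1" "?n < 1" by (meson power_less_imp_less_base zero_le_one)+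
  then show ?thesis by (auto simp: padic_radical_def)
qed

text \<open>
  The part of an expansion of degree at most 0 is one of the small elements of \<open>L\<close>, and the rest has
  positive valuation.  Together with \<open>floor_unique\<close> this determines the floor.
\<close>

lemma digit_expansion_floor:
  assumes "digit_expansion p (of_nat q) (of_nat p) (Quat 0 0 1 0) (special_digits p) (quat_embed p x) r c"
  defines "\<beta> \<equiv> digit_sum (of_nat q) (of_nat p) (Quat 0 0 1 0) c r 0"
  shows "\<beta> \<in> floor_values p" "x \<ominus>\<^bsub>quat_alg_rat (of_nat q) (of_nat p)\<^esub> \<beta> \<in> padic_radical p"
proof -
  let ?S = "\<lambda>n. digit_sum (of_nat q) (of_nat p) (Quat 0 0 1 0) c r (int n)"
  have c: "\<And>l. l \<ge> r \<Longrightarrow> c l \<in> special_digits p"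
    and lim: "(\<lambda>n. padic_abs p (quat_nrd rational_ring (of_nat q) (of_nat p)
        (x \<ominus>\<^bsub>quat_alg_rat (of_nat q) (of_nat p)\<^esub> ?S n))) \<longlonglongrightarrow> 0"
    using assms(1) by (auto simp: digit_expansion_embed)
  show "\<beta> \<in> floor_values p"
    unfolding \<beta>_def by (rule digit_sum_floor_values[OF p_pos c])
  have "1 / real p > 0" using p_pos by simp
  from order_tendstoD(2)[OF lim this] obtain n where
    "x \<ominus>\<^bsub>quat_alg_rat (of_nat q) (of_nat p)\<^esub> ?S n \<in> padic_radical p"
    using small_nrd_radical by (auto simp: eventually_sequentially)
  from padic_radical_add[OF this digit_sum_tail[of r c "of_nat q" n], of "of_nat q" "of_nat p"] c
  show "x \<ominus>\<^bsub>quat_alg_rat (of_nat q) (of_nat p)\<^esub> \<beta> \<in> padic_radical p"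
    by (simp add: quat_alg_rat_simps(3) quat_alg_rat_minus \<beta>_def)
qed

text \<open>
  The digit algorithm.  An even power of \<open>j\<close> moves \<open>x\<close> into the valuation ring; then one repeatedly splits
  off a digit \<open>D y\<close> and divides the remainder \<open>y - D y\<close> by \<open>j\<close>.  The error after the digit of index \<open>n\<close>
  is an integral element times \<open>j\<^sup>n\<^sup>+\<^sup>1\<close>.
\<close>

lemma digit_expansion_exists:
  "\<exists>r c. digit_expansion p (of_nat q) (of_nat p) (Quat 0 0 1 0) (special_digits p) (quat_embed p x) r c"
proof -
  let ?B = "quat_alg_rat (of_nat q) (of_nat p)"
  obtain m where m: "x \<otimes>\<^bsub>?B\<^esub> j_power p (2 * int m) \<in> padic_integral p"
    using padic_integral_scale by blast
  define D where "D y = (SOME c. c \<in> special_digits p \<and> y \<ominus>\<^bsub>?B\<^esub> c \<in> padic_radical p)" for y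
  have "D y \<in> special_digits p \<and> y \<ominus>\<^bsub>?B\<^esub> D y \<in> padic_radical p" if "y \<in> padic_integral p" for y
    unfolding D_def by (rule someI_ex) (use padic_integral_digit[OF odd_p that] in blast)
  then have D: "\<And>y. y \<in> padic_integral p \<Longrightarrow> D y \<in> special_digits p"
    "\<And>y. y \<in> padic_integral p \<Longrightarrow> y \<ominus>\<^bsub>?B\<^esub> D y \<in> padic_radical p" by auto
  define R where "R n = ((\<lambda>y. div_j p (y \<ominus>\<^bsub>?B\<^esub> D y)) ^^ n) (x \<otimes>\<^bsub>?B\<^esub> j_power p (2 * int m))" for n
  define r where "r = - 2 * int m"
  define c where "c l = D (R (nat (l - r)))" for l
  have R_Suc: "R (Suc n) = div_j p (R n \<ominus>\<^bsub>?B\<^esub> D (R n))" for n by (simp add: R_def)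
  have R: "R n \<in> padic_integral p" for n
    by (induction n) (use m D in \<open>auto simp: R_Suc R_def[of 0] intro: div_j_radical\<close>)
  have x: "x = digit_sum (of_nat q) (of_nat p) (Quat 0 0 1 0) c r (r + int n - 1) \<oplus>\<^bsub>?B\<^esub>
      R n \<otimes>\<^bsub>?B\<^esub> j_power p (r + int n)" for n
  proof (induction n)
    case 0
    have "R 0 \<otimes>\<^bsub>?B\<^esub> j_power p r = x \<otimes>\<^bsub>?B\<^esub> (j_power p (2 * int m) \<otimes>\<^bsub>?B\<^esub> j_power p (- (2 * int m)))"
      by (simp add: R_def r_def quat_rat.m_assoc quat_alg_rat_simps(1))
    also have "\<dots> = x"
      unfolding j_power_inverse[OF p_pos] by (simp add: quat_alg_rat_simps(1))
    finally show ?case by (cases x) (simp add: digit_sum_empty quat_alg_rat_simps(3))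
  next
    case (Suc n)
    let ?S = "digit_sum (of_nat q) (of_nat p) (Quat 0 0 1 0) c r"
    let ?J = "j_power p (r + int n)"
    have "?S (r + int n - 1 + 1) = ?S (r + int n - 1) \<oplus>\<^bsub>?B\<^esub> D (R n) \<otimes>\<^bsub>?B\<^esub> ?J"
      using digit_sum_Suc[OF p_pos, of r "r + int n - 1"] by (simp add: c_def)
    moreover have "R (Suc n) \<otimes>\<^bsub>?B\<^esub> j_power p (r + int n + 1) = (R n \<ominus>\<^bsub>?B\<^esub> D (R n)) \<otimes>\<^bsub>?B\<^esub> ?J"
      unfolding R_Suc by (rule div_j_mult_j_power'[OF p_pos])
    moreover have "D (R n) \<otimes>\<^bsub>?B\<^esub> ?J \<oplus>\<^bsub>?B\<^esub> (R n \<ominus>\<^bsub>?B\<^esub> D (R n)) \<otimes>\<^bsub>?B\<^esub> ?J =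
        (D (R n) \<oplus>\<^bsub>?B\<^esub> (R n \<ominus>\<^bsub>?B\<^esub> D (R n))) \<otimes>\<^bsub>?B\<^esub> ?J"
      by (rule quat_rat.l_distr[symmetric]) (simp_all add: quat_alg_rat_simps(1))
    moreover have "D (R n) \<oplus>\<^bsub>?B\<^esub> (R n \<ominus>\<^bsub>?B\<^esub> D (R n)) = R n"
      by (simp add: quat_alg_rat_simps(3) quat_alg_rat_minus)
    ultimately have "?S (r + int n - 1 + 1) \<oplus>\<^bsub>?B\<^esub> R (Suc n) \<otimes>\<^bsub>?B\<^esub> j_power p (r + int n + 1) =
        ?S (r + int n - 1) \<oplus>\<^bsub>?B\<^esub> R n \<otimes>\<^bsub>?B\<^esub> ?J"
      by (simp add: quat_rat.a_assoc quat_alg_rat_simps(1))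
    then show ?case using Suc by (simp add: algebra_simps)
  qed
  have diff: "u \<ominus>\<^bsub>?B\<^esub> s = t" if "u = s \<oplus>\<^bsub>?B\<^esub> t" for u s t
    using that by (cases t) (simp add: quat_alg_rat_simps(3) quat_alg_rat_minus)
  have bound: "padic_abs p (quat_nrd rational_ring (of_nat q) (of_nat p)
       (x \<ominus>\<^bsub>?B\<^esub> digit_sum (of_nat q) (of_nat p) (Quat 0 0 1 0) c r (int n))) \<le> (1 / real p) ^ Suc n" for n
  proof -
    \<comment> \<open>\<open>k\<close> is the number of indices from \<open>r\<close> to \<open>n\<close>\<close>
    define k where "k = n + 1 + 2 * m"
    have k: "r + int k - 1 = int n" "r + int k = int n + 1" by (simp_all add: k_def r_def)
    have "x \<ominus>\<^bsub>?B\<^esub> digit_sum (of_nat q) (of_nat p) (Quat 0 0 1 0) c r (int n) = R k \<otimes>\<^bsub>?B\<^esub> j_power p (int n + 1)"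
      using x[of k] by (intro diff) (simp only: k add_diff_cancel_right')
    then have "padic_abs p (quat_nrd rational_ring (of_nat q) (of_nat p)
       (x \<ominus>\<^bsub>?B\<^esub> digit_sum (of_nat q) (of_nat p) (Quat 0 0 1 0) c r (int n))) =
       real p powi (- (int n + 1)) * padic_abs p (quat_nrd rational_ring (of_nat q) (of_nat p) (R k))"
      by (simp only: padic_abs_nrd_j_power)
    also have "\<dots> \<le> real p powi (- (int n + 1)) * 1"
    proof (rule mult_left_mono)
      have "(max (padic_abs p (q1 (R k))) (padic_abs p (qi (R k))))\<^sup>2 \<le> 1"
        "(max (padic_abs p (qj (R k))) (padic_abs p (qij (R k))))\<^sup>2 \<le> 1"
        using R[of k] padic_abs_nonneg[OF p] by (auto simp: padic_integral_def max_def intro!: power_le_one)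
      then show "padic_abs p (quat_nrd rational_ring (of_nat q) (of_nat p) (R k)) \<le> 1"
        unfolding padic_abs_nrd[OF p nonres] using p_gt_1[OF p] by (simp add: divide_le_eq)
    qed simp
    also have "- (int n + 1) = - int (Suc n)" by simp
    also have "real p powi (- int (Suc n)) = (1 / real p) ^ Suc n"
      unfolding power_int_minus power_int_of_nat by (simp add: power_divide inverse_eq_divide)
    finally show ?thesis by simp
  qed
  have "(\<lambda>n. (1 / real p) ^ Suc n) \<longlonglongrightarrow> 0"
    by (intro LIMSEQ_Suc LIMSEQ_power_zero) (use p_gt_1[OF p] in auto)
  then have "(\<lambda>n. padic_abs p (quat_nrd rational_ring (of_nat q) (of_nat p)
       (x \<ominus>\<^bsub>?B\<^esub> digit_sum (of_nat q) (of_nat p) (Quat 0 0 1 0) c r (int n)))) \<longlonglongrightarrow> 0"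
    by (rule tendsto_sandwich[OF always_eventually[OF allI] always_eventually[OF allI] tendsto_const, rotated 2])
      (rule padic_abs_nonneg[OF p], rule bound)
  moreover have "\<forall>l\<ge>r. c l \<in> special_digits p" using D(1) R by (simp add: c_def)
  ultimately show ?thesis unfolding digit_expansion_embed by blast
qed

text \<open>
  Two expansions of the same element may start at different indices; as an empty digit sum is 0, the
  floor is in both cases of the definition the digit sum up to index 0, and this is unique.
\<close>

lemma special_floor_embed:
  "special_floor p (of_nat q) (of_nat p) (Quat 0 0 1 0) (special_digits p) (quat_embed p x) \<in> floor_values p"
proof -
  let ?B = "quat_alg_rat (of_nat q) (of_nat p)"
  let ?E = "digit_expansion p (of_nat q) (of_nat p) (Quat 0 0 1 0) (special_digits p) (quat_embed p x)"
  let ?S = "\<lambda>r c. digit_sum (of_nat q) (of_nat p) (Quat 0 0 1 0) c r 0"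
  have if_S: "(if r > 0 then \<zero>\<^bsub>?B\<^esub> else ?S r c) = ?S r c" for r c
    by (simp add: digit_sum_empty quat_alg_rat_simps)
  obtain r c where E: "?E r c" using digit_expansion_exists by blast
  note floor = digit_expansion_floor
  have "(THE \<beta>. \<exists>r c. ?E r c \<and> \<beta> = ?S r c) = ?S r c"
  proof (rule the_equality)
    show "\<exists>r' c'. ?E r' c' \<and> ?S r c = ?S r' c'" using E by blast
  next
    fix \<beta> assume "\<exists>r c. ?E r c \<and> \<beta> = ?S r c"
    then obtain r' c' where E': "?E r' c'" "\<beta> = ?S r' c'" by blast
    have "?S r' c' \<ominus>\<^bsub>?B\<^esub> ?S r c \<in> padic_radical p"
      using padic_radical_diff[OF floor(2)[OF E] floor(2)[OF E'(1)], of "of_nat q" "of_nat p"]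
      by (simp add: quat_alg_rat_minus)
    then show "\<beta> = ?S r c"
      unfolding E'(2) by (rule floor_unique[OF floor(1)[OF E'(1)] floor(1)[OF E]])
  qed
  then show ?thesis
    unfolding special_floor_def if_S using floor(1)[OF E] by (simp only:)
qed

end

end

section \<open>Left multipliers and infinite expansions\<close>

text \<open>
  The left \<open>L\<close>-module \<open>L\<alpha> + L\<close> is stable under left multiplication by \<open>e\<close>.
\<close>

definition (in ring) left_multiplier :: "'a set \<Rightarrow> 'a \<Rightarrow> 'a \<Rightarrow> bool" where
  "left_multiplier L \<alpha> e \<longleftrightarrow>
     (\<forall>x\<in>L. \<forall>y\<in>L. \<exists>u\<in>L. \<exists>v\<in>L. e \<otimes> (x \<otimes> \<alpha> \<oplus> y) = u \<otimes> \<alpha> \<oplus> v)"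

text \<open>
  Here \<open>\<beta> = (\<alpha> - a)\<^sup>-\<^sup>1\<close>.  Since \<open>x\<beta> + y = (y\<alpha> + (x - ya))\<beta>\<close>, we have \<open>L\<beta> + L = (L\<alpha> + L)\<beta>\<close>, and a right
  factor does not change the left multipliers.
\<close>

lemma (in ring) left_multiplier_quotient:
  assumes L: "L \<subseteq> carrier R" "\<And>x y. x \<in> L \<Longrightarrow> y \<in> L \<Longrightarrow> x \<oplus> y \<in> L"
    "\<And>x y. x \<in> L \<Longrightarrow> y \<in> L \<Longrightarrow> x \<ominus> y \<in> L" "\<And>x y. x \<in> L \<Longrightarrow> y \<in> L \<Longrightarrow> x \<otimes> y \<in> L"
  assumes "a \<in> L" "\<alpha> \<in> carrier R" "\<beta> \<in> carrier R" "e \<in> carrier R"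
    and inv: "(\<alpha> \<ominus> a) \<otimes> \<beta> = \<one>"
    and mult: "left_multiplier L \<alpha> e"
  shows "left_multiplier L \<beta> e"
  unfolding left_multiplier_def
proof (intro ballI)
  fix x y assume xy: "x \<in> L" "y \<in> L"
  then have c: "x \<in> carrier R" "y \<in> carrier R" "a \<in> carrier R" using L(1) \<open>a \<in> L\<close> by auto
  have "x \<ominus> y \<otimes> a \<in> L" using xy L \<open>a \<in> L\<close> by auto
  then obtain u v where uv: "u \<in> L" "v \<in> L" "e \<otimes> (y \<otimes> \<alpha> \<oplus> (x \<ominus> y \<otimes> a)) = u \<otimes> \<alpha> \<oplus> v"
    using mult xy unfolding left_multiplier_def by blast
  then have cu: "u \<in> carrier R" "v \<in> carrier R" using L(1) by auto
  have *: "(w \<otimes> \<alpha> \<oplus> (z \<ominus> w \<otimes> a)) \<otimes> \<beta> = z \<otimes> \<beta> \<oplus> w" if "w \<in> carrier R" "z \<in> carrier R" for w z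
  proof -
    have "w \<otimes> \<alpha> \<oplus> (z \<ominus> w \<otimes> a) = z \<oplus> w \<otimes> (\<alpha> \<ominus> a)"
      using that c assms(6) by (simp add: minus_eq r_distr r_minus a_ac)
    then have "(w \<otimes> \<alpha> \<oplus> (z \<ominus> w \<otimes> a)) \<otimes> \<beta> = z \<otimes> \<beta> \<oplus> w \<otimes> ((\<alpha> \<ominus> a) \<otimes> \<beta>)"
      using that c assms(6,7) by (simp add: l_distr m_assoc)
    then show ?thesis using that by (simp add: inv)
  qed
  have "e \<otimes> (x \<otimes> \<beta> \<oplus> y) = e \<otimes> (y \<otimes> \<alpha> \<oplus> (x \<ominus> y \<otimes> a)) \<otimes> \<beta>"
    using *[of y x] c assms(6,7,8) by (simp add: m_assoc)
  also have "\<dots> = (u \<otimes> \<alpha> \<oplus> v) \<otimes> \<beta>" by (simp only: uv(3))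
  also have "u \<otimes> \<alpha> \<oplus> v = u \<otimes> \<alpha> \<oplus> ((v \<oplus> u \<otimes> a) \<ominus> u \<otimes> a)"
    using cu c assms(6) by (simp add: minus_eq a_assoc r_neg)
  also have "\<dots> \<otimes> \<beta> = (v \<oplus> u \<otimes> a) \<otimes> \<beta> \<oplus> u"
    by (rule *) (use cu c in auto)
  finally show "\<exists>u\<in>L. \<exists>v\<in>L. e \<otimes> (x \<otimes> \<beta> \<oplus> y) = u \<otimes> \<beta> \<oplus> v"
    by (intro bexI[of _ "v \<oplus> u \<otimes> a"] bexI[of _ u]) (use uv(1,2) L \<open>a \<in> L\<close> in auto)
qed

text \<open>
  For \<open>\<alpha> \<in> L\<close> the module is \<open>L\<close>, which contains \<open>e = e 1\<close>.
\<close>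

lemma (in ring) left_multiplier_in:
  assumes L: "L \<subseteq> carrier R" "\<And>x y. x \<in> L \<Longrightarrow> y \<in> L \<Longrightarrow> x \<oplus> y \<in> L"
    "\<And>x y. x \<in> L \<Longrightarrow> y \<in> L \<Longrightarrow> x \<otimes> y \<in> L" "\<zero> \<in> L" "\<one> \<in> L"
  assumes "\<alpha> \<in> L" "e \<in> carrier R" "left_multiplier L \<alpha> e"
  shows "e \<in> L"
proof -
  obtain u v where uv: "u \<in> L" "v \<in> L" "e \<otimes> (\<zero> \<otimes> \<alpha> \<oplus> \<one>) = u \<otimes> \<alpha> \<oplus> v"
    using assms(8) L(4,5) unfolding left_multiplier_def by blast
  have "\<alpha> \<in> carrier R" using L assms by auto
  then have "e = u \<otimes> \<alpha> \<oplus> v" using uv(3) assms(7) by simp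
  then show ?thesis using uv L assms(6) by simp
qed

text \<open>
  The ring \<open>L\<close> of quaternions with coordinates in \<open>\<int>[1/p]\<close>, in which all floors lie.
\<close>

definition p_lattice :: "nat \<Rightarrow> rat quat set" where
  "p_lattice p = {x. q1 x \<in> p_rationals p \<and> qi x \<in> p_rationals p \<and>
     qj x \<in> p_rationals p \<and> qij x \<in> p_rationals p}"

lemma p_lattice_closed:
  assumes "x \<in> p_lattice p" "y \<in> p_lattice p"
  shows "x \<oplus>\<^bsub>quat_alg_rat (of_nat q) (of_nat p)\<^esub> y \<in> p_lattice p"
    "x \<ominus>\<^bsub>quat_alg_rat (of_nat q) (of_nat p)\<^esub> y \<in> p_lattice p"
    "x \<otimes>\<^bsub>quat_alg_rat (of_nat q) (of_nat p)\<^esub> y \<in> p_lattice p"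
  using assms
  by (simp_all add: p_lattice_def quat_alg_rat_simps(2,3) quat_alg_rat_minus quat_mult_rat)

text \<open>
  The module \<open>Le + L\<close> for \<open>e = (1 + i)/2\<close> consists of the elements whose coordinates \<open>a, b, c, d\<close> satisfy
  \<open>2a, 2b, 2c, 2d, a - b, c - d \<in> \<int>[1/p]\<close>.  It is a ring because \<open>e\<^sup>2 = e + (q - 1)/4\<close> and
  \<open>j e = (1 - e) j\<close>.
\<close>

lemma multiplier_1_mod_4:
  assumes "[q = 1] (mod 4)"
  defines "e \<equiv> Quat (1/2) (1/2) 0 0"
  shows "ring.left_multiplier (quat_alg_rat (of_nat q) (of_nat p)) (p_lattice p) e e"
  unfolding quat_rat.left_multiplier_def
proof (intro ballI)
  let ?B = "quat_alg_rat (of_nat q) (of_nat p)"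
  fix x y assume xy: "x \<in> p_lattice p" "y \<in> p_lattice p"
  have "q mod 4 = 1" using assms(1) by (simp add: cong_def)
  then have "q = 4 * (q div 4) + 1" by presburger
  then obtain k where "q = 4 * k + 1" by blast
  then have q: "(of_nat q :: rat) = 4 * of_nat k + 1" by simp
  obtain x1 x2 x3 x4 y1 y2 y3 y4 where x: "x = Quat x1 x2 x3 x4" and y: "y = Quat y1 y2 y3 y4"
    by (cases x, cases y) auto
  define K :: rat where "K = of_nat k"
  \<comment> \<open>The element \<open>u\<close> of \<open>L\<close> is chosen in \<open>\<int>[1/p] + \<int>[1/p] j\<close> such that \<open>u e\<close> has the same \<open>i\<close>- and
    \<open>j\<close>-coordinates as \<open>e (x e + y)\<close>; then \<open>v\<close> is the difference.\<close>
  define u where "u = Quat (x1 + (2 * K + 1) * x2 + y1 + y2) 0 (y3 + (4 * K + 1) * y4 - 2 * K * x3) 0"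
  define v where "v = Quat (K * (x1 + x2) + 2 * K * y2) 0 0 (y3 + (2 * K + 1) * y4 - K * x3 - K * x4)"
  have "u \<in> p_lattice p" "v \<in> p_lattice p"
    using xy by (simp_all add: u_def v_def x y K_def p_lattice_def)
  moreover have "e \<otimes>\<^bsub>?B\<^esub> (x \<otimes>\<^bsub>?B\<^esub> e \<oplus>\<^bsub>?B\<^esub> y) = u \<otimes>\<^bsub>?B\<^esub> e \<oplus>\<^bsub>?B\<^esub> v"
    unfolding q K_def[symmetric]
    by (simp add: e_def u_def v_def x y quat_alg_rat_simps(2,3) quat_mult_rat field_simps)
  ultimately show "\<exists>u\<in>p_lattice p. \<exists>v\<in>p_lattice p.
      e \<otimes>\<^bsub>?B\<^esub> (x \<otimes>\<^bsub>?B\<^esub> e \<oplus>\<^bsub>?B\<^esub> y) = u \<otimes>\<^bsub>?B\<^esub> e \<oplus>\<^bsub>?B\<^esub> v" by blast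
qed

text \<open>
  Now \<open>Le + L\<close> consists of the elements with \<open>a, 2b, c, b - d \<in> \<int>[1/p]\<close>.  It is a ring because
  \<open>e\<^sup>2 = (1 - p)/2\<close>, \<open>e i = 1 - j\<close> and \<open>e j = e + (p - 1)/2 i\<close>.
\<close>

lemma multiplier_2:
  assumes "odd p"
  defines "e \<equiv> Quat 0 (1/2) 0 (1/2)"
  shows "ring.left_multiplier (quat_alg_rat 2 (of_nat p)) (p_lattice p) e e"
  unfolding quat_rat.left_multiplier_def
proof (intro ballI)
  let ?B = "quat_alg_rat 2 (of_nat p)"
  fix x y assume xy: "x \<in> p_lattice p" "y \<in> p_lattice p"
  obtain k where "p = 2 * k + 1" using assms(1) by (rule oddE)
  then have p: "(of_nat p :: rat) = 2 * of_nat k + 1" by simp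
  obtain x1 x2 x3 x4 y1 y2 y3 y4 where x: "x = Quat x1 x2 x3 x4" and y: "y = Quat y1 y2 y3 y4"
    by (cases x, cases y) auto
  define K :: rat where "K = of_nat k"
  \<comment> \<open>The scalar \<open>u\<close> matches the \<open>ij\<close>-coordinate of \<open>e (x e + y)\<close>, and \<open>v\<close> is the difference.\<close>
  define u where "u = Quat (2 * x2 - (2 * K + 2) * x4 + y1 + y3) 0 0 0"
  define v where "v = Quat (y2 - (2 * K + 1) * y4 - K * x1) (K * (x2 - x4 + y3)) (K * x3 + y4 - y2) 0"
  have "u \<in> p_lattice p" "v \<in> p_lattice p"
    using xy by (simp_all add: u_def v_def x y K_def p_lattice_def)
  moreover have "e \<otimes>\<^bsub>?B\<^esub> (x \<otimes>\<^bsub>?B\<^esub> e \<oplus>\<^bsub>?B\<^esub> y) = u \<otimes>\<^bsub>?B\<^esub> e \<oplus>\<^bsub>?B\<^esub> v"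
    unfolding p K_def[symmetric]
    by (simp add: e_def u_def v_def x y quat_alg_rat_simps(2,3) quat_mult_rat field_simps)
  ultimately show "\<exists>u\<in>p_lattice p. \<exists>v\<in>p_lattice p.
      e \<otimes>\<^bsub>?B\<^esub> (x \<otimes>\<^bsub>?B\<^esub> e \<oplus>\<^bsub>?B\<^esub> y) = u \<otimes>\<^bsub>?B\<^esub> e \<oplus>\<^bsub>?B\<^esub> v" by blast
qed

text \<open>
  Every complete quotient \<open>\<gamma>\<close> of \<open>\<alpha>\<close> exists, lies in \<open>B\<close> and has \<open>e\<close> as a left multiplier: if \<open>\<gamma>\<close> were
  equal to its floor, it would lie in \<open>L\<close>, and so would \<open>e\<close>.
\<close>

lemma infinite_expansion:
  fixes p q :: nat
  assumes p: "prime p" and nonres: "\<not> QuadRes (int p) (int q)"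
    and floor: "\<And>x. special_floor p (of_nat q) (of_nat p) (Quat 0 0 1 0) (special_digits p) (quat_embed p x) \<in> p_lattice p"
    and e: "e \<notin> p_lattice p" and mult: "ring.left_multiplier (quat_alg_rat (of_nat q) (of_nat p)) (p_lattice p) \<alpha> e"
  shows "\<not> finite_cf_expansion (special_type q p) (quat_embed p \<alpha>)"
proof -
  let ?B = "quat_alg_rat (of_nat q) (of_nat p)"
  let ?\<tau> = "special_type q p"
  have "\<exists>\<gamma>. complete_quot ?\<tau> (quat_embed p \<alpha>) n = Some (quat_embed p \<gamma>) \<and>
      ring.left_multiplier ?B (p_lattice p) \<gamma> e" for n
  proof (induction n)
    case 0
    then show ?case using mult by auto
  next
    case (Suc n)
    then obtain \<gamma> where \<gamma>: "complete_quot ?\<tau> (quat_embed p \<alpha>) n = Some (quat_embed p \<gamma>)"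
      "ring.left_multiplier ?B (p_lattice p) \<gamma> e" by blast
    define a where "a = type_floor ?\<tau> (quat_embed p \<gamma>)"
    have a: "a \<in> p_lattice p" using floor by (simp add: a_def special_type_def)
    have "\<gamma> \<noteq> a"
    proof
      assume "\<gamma> = a"
      then have "e \<in> p_lattice p"
        by (intro quat_rat.left_multiplier_in[OF _ _ _ _ _ _ _ \<gamma>(2)])
          (use a in \<open>auto simp: quat_alg_rat_simps(1,4,5) p_lattice_closed\<close>, auto simp: p_lattice_def)
      then show False using e by blast
    qed
    then have "\<gamma> \<ominus>\<^bsub>?B\<^esub> a \<noteq> Quat 0 0 0 0"
      by (auto simp: quat_alg_rat_minus intro: quat.expand)
    then have "quat_nrd rational_ring (of_nat q) (of_nat p) (\<gamma> \<ominus>\<^bsub>?B\<^esub> a) \<noteq> 0"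
      using nrd_eq_0_iff[OF p nonres] by blast
    then obtain \<beta> where \<beta>: "(\<gamma> \<ominus>\<^bsub>?B\<^esub> a) \<otimes>\<^bsub>?B\<^esub> \<beta> = \<one>\<^bsub>?B\<^esub>" "\<beta> \<otimes>\<^bsub>?B\<^esub> (\<gamma> \<ominus>\<^bsub>?B\<^esub> a) = \<one>\<^bsub>?B\<^esub>"
      using quat_alg_rat_inv by blast
    have "quat_embed p \<gamma> \<noteq> quat_embed p a"
      using \<open>\<gamma> \<noteq> a\<close> inj_quat_embed[OF p] by (simp add: inj_eq)
    then have "complete_quot ?\<tau> (quat_embed p \<alpha>) (Suc n) = Some (quat_embed p \<beta>)"
      using \<gamma>(1) quat_embed_inv[OF p \<beta>] quat_embed_minus[OF p, where x = \<gamma> and y = a and a = "of_nat q" and b = "of_nat p"]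
      by (simp add: Let_def a_def special_type_def type_alg_padic_def)
    moreover have "ring.left_multiplier ?B (p_lattice p) \<beta> e"
      by (rule quat_rat.left_multiplier_quotient[OF _ _ _ _ a _ _ _ \<beta>(1) \<gamma>(2)])
        (auto simp: quat_alg_rat_simps(1) p_lattice_closed)
    ultimately show ?case by blast
  qed
  then show ?thesis by (auto simp: finite_cf_expansion_def cf_expansion_def)
qed

theorem theorem6p1:
  fixes p q :: nat
  assumes "prime p" and "p \<ge> 3" and "prime q"
    and "([q = 1] (mod 4) \<and> Legendre (int p) (int q) = -1) \<or> (q = 2 \<and> [p = 3] (mod 8))"
  shows "\<not> QCFF (special_type q p)"
proof
  assume QCFF: "QCFF (special_type q p)"
  have odd: "odd p" using assms(1,2) prime_odd_nat[of p] by simp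
  have nonres: "\<not> QuadRes (int p) (int q)" by (rule special_nonresidue[OF assms])
  have half: "1 / 2 \<notin> p_rationals p" by (rule half_not_p_rational[OF odd])
  obtain e where e: "e \<notin> p_lattice p"
    "ring.left_multiplier (quat_alg_rat (of_nat q) (of_nat p)) (p_lattice p) e e"
    using assms(4)
  proof
    assume "[q = 1] (mod 4) \<and> Legendre (int p) (int q) = -1"
    then have "[q = 1] (mod 4)" by blast
    from multiplier_1_mod_4[OF this] show ?thesis
      by (rule that[rotated]) (use half in \<open>simp add: p_lattice_def\<close>)
  next
    assume "q = 2 \<and> [p = 3] (mod 8)"
    then have "ring.left_multiplier (quat_alg_rat (of_nat q) (of_nat p)) (p_lattice p)
        (Quat 0 (1/2) 0 (1/2)) (Quat 0 (1/2) 0 (1/2))"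
      using multiplier_2[OF odd] by simp
    then show ?thesis
      by (rule that[rotated]) (use half in \<open>simp add: p_lattice_def\<close>)
  qed
  have "special_floor p (of_nat q) (of_nat p) (Quat 0 0 1 0) (special_digits p) (quat_embed p x)
      \<in> p_lattice p" for x
    using special_floor_embed[OF assms(1) odd nonres, of x] by (simp add: floor_values_def p_lattice_def)
  from infinite_expansion[OF assms(1) nonres this e]
  have "\<not> finite_cf_expansion (special_type q p) (quat_embed p e)" .
  moreover have "e \<in> carrier (type_alg (special_type q p))"
    by (simp add: type_alg_def quat_alg_rat_simps)
  ultimately show False
    using QCFF by (auto simp: QCFF_def special_type_def)
qed

end
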